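(* For every odd integer $t\geq 7$, \[ \mathrm{La}(n,\mathcal{O}_{2t})=(1+o(1))\binom{n}{\lfloor n/2\rfloor}\qquad (n\to\infty). \]
   Context: For posets $P=(P,\le)$ and $P'=(P',\le')$, $P'$ is a (weak) subposet of $P$ if there is an injection $f\colon P'\to P$ such that $u\le' v$ implies $f(u)\le f(v)$. A family $\mathcal{F}$ of subsets of $[n]=\{1,\dots,n\}$ is $P$-free if $P$ is not a weak subposet of $(\mathcal{F},\subseteq)$. $\mathrm{La}(n,P)$ denotes the largest size of a $P$-free family of subsets of $[n]$. For $t\ge 2$, the crown $\mathcal{O}_{2t}$ is the height-2 poset whose Hasse diagram is a cycle of length $2t$ (i.e. elements $a_1,\dots,a_t$ (minimal) and $b_1,\dots,b_t$ (maximal) with $a_i<b_i$ and $a_{i+1}<b_i$, indices mod $t$, and no other relations). *)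

theory Defs
  imports Main "HOL-Library.Landau_Symbols"
begin

definition weak_subposet ::
  "'a set \<Rightarrow> ('a \<Rightarrow> 'a \<Rightarrow> bool) \<Rightarrow> 'b set \<Rightarrow> ('b \<Rightarrow> 'b \<Rightarrow> bool) \<Rightarrow> bool" where
  "weak_subposet A le' B le \<longleftrightarrow>
     (\<exists>f. inj_on f A \<and> f ` A \<subseteq> B \<and> (\<forall>u\<in>A. \<forall>v\<in>A. le' u v \<longrightarrow> le (f u) (f v)))"

definition P_free :: "nat set set \<Rightarrow> 'a set \<Rightarrow> ('a \<Rightarrow> 'a \<Rightarrow> bool) \<Rightarrow> bool" where
  "P_free F A le \<longleftrightarrow> \<not> weak_subposet A le F (\<subseteq>)"

definition La :: "nat \<Rightarrow> 'a set \<Rightarrow> ('a \<Rightarrow> 'a \<Rightarrow> bool) \<Rightarrow> nat" where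
  "La n A le = Max {card F | F. F \<subseteq> Pow {1..n} \<and> P_free F A le}"

text \<open>The crown O_{2t}: elements (False,i) = a_i and (True,i) = b_i for i < t (indices 0..t-1),
  with a_i < b_i and a_{i+1 mod t} < b_i, plus reflexivity.\<close>
definition crown_carrier :: "nat \<Rightarrow> (bool \<times> nat) set" where
  "crown_carrier t = {(b, i). i < t}"

definition crown_le :: "nat \<Rightarrow> bool \<times> nat \<Rightarrow> bool \<times> nat \<Rightarrow> bool" where
  "crown_le t x y \<longleftrightarrow> x = y \<or>
     (fst x = False \<and> fst y = True \<and> (snd x = snd y \<or> snd x = (snd y + 1) mod t))"

end

theory Submission
  imports Defs "HOL-Probability.Hoeffding" "HOL-Real_Asymp.Real_Asymp"
begin

text \<open>
  The middle layer gives the lower bound. For the upper bound let \<open>F\<close> have at least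
  \<open>(1 + \<epsilon>)\<close> times the size of the middle layer. A uniformly random maximal chain meets \<open>F\<close>, in
  layers close to the middle, \<open>1 + \<epsilon>/2\<close> times on average, so the expected number of pairs of members
  of \<open>F\<close> on it is a constant fraction of the expected number of members. Hence some layer
  \<open>b\<close> has the property that members of \<open>F\<close> in layer \<open>b\<close> have, on average, a constant number of members of \<open>F\<close>
  below them on a random chain. Running many chains downwards through disjoint parts of such a
  member \<open>A\<close> gives disjoint blocks \<open>x\<close>, \<open>y\<close>, \<open>z\<close> of \<open>A\<close> such that, with not too small probability,
  \<open>A\<close>, \<open>A - x\<close>, \<open>A - y\<close> and \<open>A - z\<close> all belong to \<open>F\<close>.

  Now \<open>A = W \<union> x \<union> y \<union> z\<close> is a point of a three-dimensional grid with coordinates \<open>x\<close>, \<open>y\<close>, \<open>z\<close>, and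
  the sets \<open>W \<union> y \<union> z\<close>, \<open>W \<union> x \<union> z\<close>, \<open>W \<union> x \<union> y\<close> are the lines through it. Three applications of the
  power mean inequality produce a complete \<open>s \<times> s \<times> s\<close> grid all of whose points and lines
  lie in \<open>F\<close>. When the three gaps are bounded the density is constant and the number of blocks
  tends to infinity; when they are at least a large constant, the density is only polynomially small
  while the number of blocks is a larger power of \<open>n\<close>. A closed walk of odd length \<open>t \<ge> 7\<close> in the
  grid, moving along distinct lines, is a crown: its points are the upper elements and its lines the
  lower ones.
\<close>

section \<open>Complete grids in dense systems\<close>

text \<open>A power lies above its tangent at \<open>c\<close>. In the induction step,
  \<open>x\<close> times the old tangent exceeds the new one by a nonnegative multiple of the square
  of \<open>x - c\<close>.\<close>

lemma power_tangent_le: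
  fixes x c :: real
  assumes "0 \<le> x" "0 \<le> c"
  shows "real (Suc n) * c ^ n * x - real n * c ^ Suc n \<le> x ^ Suc n"
proof (induction n)
  case (Suc n)
  have "0 \<le> real (Suc n) * c ^ n * (x - c)\<^sup>2"
    using assms by simp
  then have "real (Suc (Suc n)) * c ^ Suc n * x - real (Suc n) * c ^ Suc (Suc n)
      \<le> x * (real (Suc n) * c ^ n * x - real n * c ^ Suc n)"
    by (simp add: algebra_simps power2_eq_square)
  also have "\<dots> \<le> x * x ^ Suc n"
    using Suc assms(1) by (rule mult_left_mono)
  finally show ?case by simp
qed simp

abbreviation tuples :: "nat \<Rightarrow> 'a set \<Rightarrow> (nat \<Rightarrow> 'a) set"
  where "tuples s A \<equiv> PiE {..<s} (\<lambda>_. A)"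

lemma card_tuples: "card (tuples s A) = card A ^ s"
  by (simp add: card_PiE)

lemma finite_tuples: "finite A \<Longrightarrow> finite (tuples s A)"
  by (simp add: finite_PiE)

text \<open>Power mean inequality for the degrees \<open>d q\<close>: at most \<open>\<mu>\<close>
  of them are nonzero, and their sum is at least \<open>\<mu>\<close> times
  \<open>e * card Z\<close>. Zero degrees may be ignored because \<open>s\<close> is
  positive.\<close>

lemma card_tuples_pair_ge:
  fixes e \<mu> :: real
  assumes fin: "finite Q" "finite Z" and "0 \<le> e"
    and pr: "card {q \<in> Q. \<exists>z\<in>Z. r q z} \<le> \<mu>"
    and many: "e * \<mu> * card Z \<le> card {(q, z) \<in> Q \<times> Z. r q z}"
    and "0 < s"
  shows "e ^ s * \<mu> * card Z ^ s \<le> card {(q, f) \<in> Q \<times> tuples s Z. \<forall>k<s. r q (f k)}"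
proof -
  obtain n where s: "s = Suc n" using \<open>0 < s\<close> gr0_implies_Suc by blast
  define Q' where "Q' = {q \<in> Q. \<exists>z\<in>Z. r q z}"
  define d where "d q = card {z \<in> Z. r q z}" for q
  define c where "c = e * card Z"
  have finQ': "finite Q'" using fin by (simp add: Q'_def)
  have c0: "0 \<le> c" using \<open>0 \<le> e\<close> by (simp add: c_def)
  have "{(q, z) \<in> Q \<times> Z. r q z} = (SIGMA q:Q'. {z \<in> Z. r q z})"
    by (auto simp: Q'_def)
  then have total: "card {(q, z) \<in> Q \<times> Z. r q z} = (\<Sum>q\<in>Q'. d q)"
    using fin finQ' by (simp add: d_def card_SigmaI)
  have "{(q, f) \<in> Q \<times> tuples s Z. \<forall>k<s. r q (f k)} = (SIGMA q:Q'. tuples s {z \<in> Z. r q z})"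
  proof (intro equalityI subsetI, goal_cases)
    case (1 p)
    then obtain q f where p: "p = (q, f)" "q \<in> Q" "f \<in> tuples s Z" "\<forall>k<s. r q (f k)" by auto
    have "f 0 \<in> Z" "r q (f 0)" using p \<open>0 < s\<close> by (auto simp: PiE_iff)
    then show ?case using p by (auto simp: Q'_def PiE_iff)
  next
    case (2 p)
    then obtain q f where p: "p = (q, f)" "q \<in> Q'" "f \<in> tuples s {z \<in> Z. r q z}" by blast
    have "f \<in> tuples s Z" "\<forall>k<s. r q (f k)" using p(3) by (simp_all add: PiE_iff)
    moreover have "q \<in> Q" using p(2) by (simp add: Q'_def)
    ultimately show ?case using p(1) by simp
  qed
  then have tup: "card {(q, f) \<in> Q \<times> tuples s Z. \<forall>k<s. r q (f k)} = (\<Sum>q\<in>Q'. d q ^ s)"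
    using fin finQ' by (simp add: card_SigmaI finite_tuples card_tuples d_def)
  \<comment> \<open>Tangents at \<open>c\<close> are summed instead of forming an average: the
    number of nonzero degrees enters with a negative sign, so an upper bound on it suffices.\<close>
  have "e ^ s * \<mu> * card Z ^ s = real (Suc n) * c ^ n * (c * \<mu>) - real n * c ^ Suc n * \<mu>"
    by (simp add: c_def s algebra_simps power_mult_distrib)
  also have "\<dots> \<le> real (Suc n) * c ^ n * (\<Sum>q\<in>Q'. real (d q)) - real n * c ^ Suc n * card Q'"
  proof (rule diff_mono)
    show "real (Suc n) * c ^ n * (c * \<mu>) \<le> real (Suc n) * c ^ n * (\<Sum>q\<in>Q'. real (d q))"
    proof (rule mult_left_mono)
      show "c * \<mu> \<le> (\<Sum>q\<in>Q'. real (d q))"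
        using many unfolding total c_def by (simp add: mult_ac)
      show "0 \<le> real (Suc n) * c ^ n" using c0 by simp
    qed
    show "real n * c ^ Suc n * card Q' \<le> real n * c ^ Suc n * \<mu>"
      using pr c0 by (intro mult_left_mono) (auto simp: Q'_def)
  qed
  also have "\<dots> = (\<Sum>q\<in>Q'. real (Suc n) * c ^ n * real (d q) - real n * c ^ Suc n)"
    by (simp only: sum_subtractf sum_distrib_left sum_constant) (simp add: algebra_simps)
  also have "\<dots> \<le> (\<Sum>q\<in>Q'. real (d q) ^ Suc n)"
    using c0 by (intro sum_mono power_tangent_le) auto
  finally show ?thesis
    unfolding tup by (simp add: s)
qed

text \<open>Union bound over the ordered pairs of distinct positions carrying the same entry; such a
  repetition leaves \<open>s - 1\<close> free entries.\<close>

lemma card_noninj_tuples_le: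
  assumes "finite X"
  shows "card {f \<in> tuples s X. \<not> inj_on f {..<s}} * card X \<le> s\<^sup>2 * card X ^ s"
proof -
  define P where "P = {(i, j). i < s \<and> j < s \<and> i \<noteq> j}"
  have P: "P \<subseteq> {..<s} \<times> {..<s}" by (auto simp: P_def)
  then have finP: "finite P" using finite_subset by blast
  have cardP: "card P \<le> s\<^sup>2"
    using card_mono[OF _ P] by (simp add: power2_eq_square)
  have "{f \<in> tuples s X. \<not> inj_on f {..<s}} \<subseteq> (\<Union>(i,j)\<in>P. {f \<in> tuples s X. f i = f j})"
    by (auto simp: P_def inj_on_def)
  then have "card {f \<in> tuples s X. \<not> inj_on f {..<s}} \<le> card (\<Union>(i,j)\<in>P. {f \<in> tuples s X. f i = f j})"
    using finP finite_tuples[OF assms] by (intro card_mono) auto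
  also have "\<dots> \<le> (\<Sum>(i,j)\<in>P. card {f \<in> tuples s X. f i = f j})"
    using card_UN_le[OF finP, of "\<lambda>(i,j). {f \<in> tuples s X. f i = f j}"]
    by (simp add: case_prod_unfold)
  also have "\<dots> \<le> (\<Sum>(i,j)\<in>P. card X ^ (s - 1))"
  proof (intro sum_mono, clarify)
    fix i j assume "(i, j) \<in> P"
    then have ij: "i < s" "j < s" "i \<noteq> j" by (auto simp: P_def)
    \<comment> \<open>Forgetting position \<open>i\<close> loses nothing, since its entry is
      repeated at \<open>j\<close>.\<close>
    have "inj_on (\<lambda>f. restrict f ({..<s} - {i})) {f \<in> tuples s X. f i = f j}"
    proof (rule inj_onI)
      fix f g assume f: "f \<in> {f \<in> tuples s X. f i = f j}" and g: "g \<in> {f \<in> tuples s X. f i = f j}"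
        and eq: "restrict f ({..<s} - {i}) = restrict g ({..<s} - {i})"
      have eq': "f k = g k" if "k < s" "k \<noteq> i" for k
        using fun_cong[OF eq, of k] that by auto
      show "f = g"
      proof (rule PiE_ext)
        show "f \<in> tuples s X" "g \<in> tuples s X" using f g by simp_all
        fix k assume "k \<in> {..<s}"
        then show "f k = g k" using eq'[of k] eq'[of j] ij f g by (cases "k = i") auto
      qed
    qed
    moreover have "(\<lambda>f. restrict f ({..<s} - {i})) ` {f \<in> tuples s X. f i = f j} \<subseteq> PiE ({..<s} - {i}) (\<lambda>_. X)"
      by (simp add: image_subset_iff PiE_iff)
    ultimately have "card {f \<in> tuples s X. f i = f j} \<le> card (PiE ({..<s} - {i}) (\<lambda>_. X))"
      using assms by (intro card_inj_on_le) (simp_all add: finite_PiE)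
    also have "\<dots> = card X ^ (s - 1)"
      using ij by (simp add: card_PiE)
    finally show "card {f \<in> tuples s X. f i = f j} \<le> card X ^ (s - 1)" .
  qed
  also have "\<dots> = card P * card X ^ (s - 1)" by (simp add: case_prod_unfold)
  finally have *: "card {f \<in> tuples s X. \<not> inj_on f {..<s}} \<le> card P * card X ^ (s - 1)" .
  show ?thesis
  proof (cases s)
    case (Suc n)
    have "card {f \<in> tuples s X. \<not> inj_on f {..<s}} * card X \<le> (card P * card X ^ n) * card X"
      using * Suc by (intro mult_right_mono) auto
    also have "\<dots> \<le> s\<^sup>2 * card X ^ s"
      using cardP Suc by (simp add: algebra_simps mult_le_mono)
    finally show ?thesis .
  qed auto
qed

lemma card_pairs_swap:
  assumes "finite M" "finite P"
  shows "card {(m, p) \<in> M \<times> P. R m p} = (\<Sum>p\<in>P. card {m \<in> M. R m p})"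
proof -
  have "{(m, p) \<in> M \<times> P. R m p} = prod.swap ` (SIGMA p:P. {m \<in> M. R m p})"
    by force
  then have "card {(m, p) \<in> M \<times> P. R m p} = card (SIGMA p:P. {m \<in> M. R m p})"
    by (simp add: card_image)
  then show ?thesis using assms by simp
qed

lemma card_pairs_le:
  fixes u :: real
  assumes fin: "finite M" "finite P" and bound: "\<And>p. p \<in> P \<Longrightarrow> card {m \<in> M. R m p} \<le> u"
    and sub: "S \<subseteq> {(m, p) \<in> M \<times> P. R m p}"
  shows "card S \<le> u * card P"
proof -
  have "finite {(m, p) \<in> M \<times> P. R m p}"
    by (rule finite_subset[of _ "M \<times> P"]) (use fin in auto)
  then have "real (card S) \<le> card {(m, p) \<in> M \<times> P. R m p}"
    using card_mono sub by auto
  also have "\<dots> = (\<Sum>p\<in>P. real (card {m \<in> M. R m p}))"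
    unfolding card_pairs_swap[OF fin] by simp
  also have "\<dots> \<le> (\<Sum>p\<in>P. u)" using bound by (rule sum_mono)
  finally show ?thesis by (simp add: mult.commute)
qed

lemma card_pairs_ge:
  fixes u :: real
  assumes fin: "finite M" "finite P" and bound: "\<And>p. p \<in> P \<Longrightarrow> u \<le> card {m \<in> M. R m p}"
  shows "u * card P \<le> card {(m, p) \<in> M \<times> P. R m p}"
proof -
  have "u * card P = (\<Sum>p\<in>P. u)" by (simp add: mult.commute)
  also have "\<dots> \<le> (\<Sum>p\<in>P. real (card {m \<in> M. R m p}))" using bound by (rule sum_mono)
  also have "\<dots> = card {(m, p) \<in> M \<times> P. R m p}"
    unfolding card_pairs_swap[OF fin] by simp
  finally show ?thesis .
qed

text \<open>The error term for grids that degenerate in one direction: relative to the main term,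
  repeated entries cost a factor \<open>(real s)\<^sup>2 / N\<close>, which a large supply of blocks
  makes negligible.\<close>

lemma card_noninj_times_le:
  fixes u N :: real
  assumes fin: "finite M" "finite X" "finite P"
    and lines: "\<And>p. p \<in> P \<Longrightarrow> card {m \<in> M. R m p} \<le> u"
    and N: "0 < N" "N \<le> card X" and "0 \<le> u"
  shows "card ({(m, p) \<in> M \<times> P. R m p} \<times> {f \<in> tuples s X. \<not> inj_on f {..<s}})
    \<le> (real s)\<^sup>2 / N * (u * card P * card X ^ s)"
proof -
  let ?b = "card {f \<in> tuples s X. \<not> inj_on f {..<s}}"
  have "?b * N \<le> real ?b * real (card X)" using N by (intro mult_left_mono) auto
  also have "\<dots> \<le> real (s\<^sup>2 * card X ^ s)"
    unfolding of_nat_mult[symmetric] using card_noninj_tuples_le[OF fin(2)] by (rule of_nat_mono)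
  finally have b: "?b \<le> (real s)\<^sup>2 / N * card X ^ s" using N by (simp add: field_simps)
  have "card {(m, p) \<in> M \<times> P. R m p} * real ?b \<le> (u * card P) * ((real s)\<^sup>2 / N * card X ^ s)"
    using card_pairs_le[OF fin(1,3) lines order_refl] b \<open>0 \<le> u\<close> by (intro mult_mono) auto
  then show ?thesis by (simp add: card_cartesian_product mult_ac)
qed

text \<open>The grid is found by applying \<^term>\<open>card_tuples_pair_ge\<close> once per coordinate.
  Each time the
  projected set is controlled through a single line, so only the density of the good points
  relative to the lines matters, never their absolute density.\<close>
lemma exists_injective_grid:
  fixes G :: "'m \<Rightarrow> 'x \<Rightarrow> 'y \<Rightarrow> 'z \<Rightarrow> bool" and u e N :: real
  assumes fin: "finite M" "finite X" "finite Y" "finite Z"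
    and G: "\<And>m x y z. G m x y z \<Longrightarrow> A m y z \<and> B m x z \<and> C m x y"
    and A: "\<And>y z. y \<in> Y \<Longrightarrow> z \<in> Z \<Longrightarrow> card {m \<in> M. A m y z} \<le> u"
    and B: "\<And>x z. x \<in> X \<Longrightarrow> z \<in> Z \<Longrightarrow> card {m \<in> M. B m x z} \<le> u"
    and C: "\<And>x y. x \<in> X \<Longrightarrow> y \<in> Y \<Longrightarrow> card {m \<in> M. C m x y} \<le> u"
    and dense: "\<And>x y z. x \<in> X \<Longrightarrow> y \<in> Y \<Longrightarrow> z \<in> Z \<Longrightarrow> e * u \<le> card {m \<in> M. G m x y z}"
    and "0 < u" "0 \<le> e" "0 < s" "0 < N"
    and N: "N \<le> card X" "N \<le> card Y" "N \<le> card Z"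
    and big: "3 * (real s)\<^sup>2 < e ^ (s ^ 3) * N"
  obtains m f g h where "m \<in> M" "f \<in> tuples s X" "g \<in> tuples s Y" "h \<in> tuples s Z"
    "inj_on f {..<s}" "inj_on g {..<s}" "inj_on h {..<s}"
    "\<And>i j k. i < s \<Longrightarrow> j < s \<Longrightarrow> k < s \<Longrightarrow> G m (f i) (g j) (h k)"
proof -
  let ?X = "real (card X)" and ?Y = "real (card Y)" and ?Z = "real (card Z)"
  let ?TX = "tuples s X" and ?TY = "tuples s Y" and ?TZ = "tuples s Z"
  note fT = finite_tuples[OF fin(2), of s] finite_tuples[OF fin(3), of s] finite_tuples[OF fin(4), of s]
  have s0: "0 \<in> {..<s}" using \<open>0 < s\<close> by simp
  have A0: "card {m \<in> M. A m (g 0) (h 0)} \<le> u" if "g \<in> ?TY" "h \<in> ?TZ" for g h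
    using A PiE_mem[OF that(1) s0] PiE_mem[OF that(2) s0] .
  have B0: "card {m \<in> M. B m (f 0) (h 0)} \<le> u" if "f \<in> ?TX" "h \<in> ?TZ" for f h
    using B PiE_mem[OF that(1) s0] PiE_mem[OF that(2) s0] .
  have B1: "card {m \<in> M. B m x (h 0)} \<le> u" if "x \<in> X" "h \<in> ?TZ" for x h
    using B that(1) PiE_mem[OF that(2) s0] .
  have C0: "card {m \<in> M. C m (f 0) (g 0)} \<le> u" if "f \<in> ?TX" "g \<in> ?TY" for f g
    using C PiE_mem[OF that(1) s0] PiE_mem[OF that(2) s0] .
  \<comment> \<open>Single coordinates are replaced by \<open>s\<close>-tuples one direction at a
    time: first \<open>z\<close>, then \<open>y\<close>, then \<open>x\<close>. Each round raises
    the density to the power \<open>s\<close>, ending at \<open>e ^ (s ^ 3)\<close>.\<close>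
  define S1 where "S1 = {(q, h) \<in> (M \<times> X \<times> Y) \<times> ?TZ. \<forall>k<s. case q of (m, x, y) \<Rightarrow> G m x y (h k)}"
  define S2 where "S2 = {(q, g) \<in> (M \<times> X \<times> ?TZ) \<times> ?TY.
    \<forall>j<s. case q of (m, x, h) \<Rightarrow> \<forall>k<s. G m x (g j) (h k)}"
  define S3 where "S3 = {(q, f) \<in> (M \<times> ?TY \<times> ?TZ) \<times> ?TX.
    \<forall>i<s. case q of (m, g, h) \<Rightarrow> \<forall>j<s. \<forall>k<s. G m (f i) (g j) (h k)}"
  have c1: "e ^ s * (u * (?X * ?Y)) * ?Z ^ s \<le> card S1"
  proof -
    have "e ^ s * (u * (?X * ?Y)) * card Z ^ s \<le> card S1"
      unfolding S1_def
    proof (rule card_tuples_pair_ge)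
      have "card {q \<in> M \<times> X \<times> Y. \<exists>z\<in>Z. case q of (m, x, y) \<Rightarrow> G m x y z} \<le> u * card (X \<times> Y)"
        by (rule card_pairs_le[where R = "\<lambda>m p. C m (fst p) (snd p)"]) (use fin C G in auto)
      then show "card {q \<in> M \<times> X \<times> Y. \<exists>z\<in>Z. case q of (m, x, y) \<Rightarrow> G m x y z} \<le> u * (?X * ?Y)"
        by (simp add: card_cartesian_product)
      have "e * u * card (X \<times> Y \<times> Z)
        \<le> card {(m, p) \<in> M \<times> X \<times> Y \<times> Z. G m (fst p) (fst (snd p)) (snd (snd p))}"
        using fin dense by (intro card_pairs_ge) auto
      also have "card {(m, p) \<in> M \<times> X \<times> Y \<times> Z. G m (fst p) (fst (snd p)) (snd (snd p))}
        = card {(q, z) \<in> (M \<times> X \<times> Y) \<times> Z. case q of (m, x, y) \<Rightarrow> G m x y z}"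
        by (rule bij_betw_same_card[of "\<lambda>(m, x, y, z). ((m, x, y), z)"],
            rule bij_betwI[where g = "\<lambda>((m, x, y), z). (m, x, y, z)"]) auto
      finally show "e * (u * (?X * ?Y)) * card Z
        \<le> card {(q, z) \<in> (M \<times> X \<times> Y) \<times> Z. case q of (m, x, y) \<Rightarrow> G m x y z}"
        by (simp add: card_cartesian_product mult_ac)
    qed (use fin \<open>0 \<le> e\<close> \<open>0 < s\<close> in auto)
    then show ?thesis by simp
  qed
  have c2: "(e ^ s) ^ s * (u * (?X * ?Z ^ s)) * ?Y ^ s \<le> card S2"
  proof -
    have "(e ^ s) ^ s * (u * (?X * ?Z ^ s)) * card Y ^ s \<le> card S2"
      unfolding S2_def
    proof (rule card_tuples_pair_ge)
      \<comment> \<open>The single entry \<open>h 0\<close> of the tuple already gives a line that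
        bounds the projection.\<close>
      have "card {q \<in> M \<times> X \<times> ?TZ. \<exists>y\<in>Y. case q of (m, x, h) \<Rightarrow> \<forall>k<s. G m x y (h k)}
          \<le> u * card (X \<times> ?TZ)"
        by (rule card_pairs_le[where R = "\<lambda>m p. B m (fst p) (snd p 0)"])
           (use fin fT B1 G \<open>0 < s\<close> in auto)
      then show "card {q \<in> M \<times> X \<times> ?TZ. \<exists>y\<in>Y. case q of (m, x, h) \<Rightarrow> \<forall>k<s. G m x y (h k)}
          \<le> u * (?X * ?Z ^ s)"
        by (simp add: card_cartesian_product card_tuples)
      have "card S1 = card {(q, y) \<in> (M \<times> X \<times> ?TZ) \<times> Y. case q of (m, x, h) \<Rightarrow> \<forall>k<s. G m x y (h k)}"
        unfolding S1_def
        by (rule bij_betw_same_card[of "\<lambda>((m, x, y), h). ((m, x, h), y)"],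
            rule bij_betwI[where g = "\<lambda>((m, x, h), y). ((m, x, y), h)"]) auto
      then show "e ^ s * (u * (?X * ?Z ^ s)) * card Y
        \<le> card {(q, y) \<in> (M \<times> X \<times> ?TZ) \<times> Y. case q of (m, x, h) \<Rightarrow> \<forall>k<s. G m x y (h k)}"
        using c1 by (simp add: mult_ac)
    qed (use fin fT \<open>0 \<le> e\<close> \<open>0 < s\<close> in auto)
    then show ?thesis by simp
  qed
  have c3: "((e ^ s) ^ s) ^ s * (u * (?Y ^ s * ?Z ^ s)) * ?X ^ s \<le> card S3"
  proof -
    have "((e ^ s) ^ s) ^ s * (u * (?Y ^ s * ?Z ^ s)) * card X ^ s \<le> card S3"
      unfolding S3_def
    proof (rule card_tuples_pair_ge)
      have sub: "{q \<in> M \<times> ?TY \<times> ?TZ. \<exists>x\<in>X. case q of (m, g, h) \<Rightarrow> \<forall>j<s. \<forall>k<s. G m x (g j) (h k)}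
          \<subseteq> {(m, p) \<in> M \<times> ?TY \<times> ?TZ. A m (fst p 0) (snd p 0)}"
      proof
        fix q assume "q \<in> {q \<in> M \<times> ?TY \<times> ?TZ.
          \<exists>x\<in>X. case q of (m, g, h) \<Rightarrow> \<forall>j<s. \<forall>k<s. G m x (g j) (h k)}"
        then obtain m g h x where q: "q = (m, g, h)" "m \<in> M" "g \<in> ?TY" "h \<in> ?TZ"
          and "\<forall>j<s. \<forall>k<s. G m x (g j) (h k)" by auto
        then have "A m (g 0) (h 0)" using G \<open>0 < s\<close> by blast
        then show "q \<in> {(m, p) \<in> M \<times> ?TY \<times> ?TZ. A m (fst p 0) (snd p 0)}" using q by simp
      qed
      have "card {q \<in> M \<times> ?TY \<times> ?TZ. \<exists>x\<in>X. case q of (m, g, h) \<Rightarrow> \<forall>j<s. \<forall>k<s. G m x (g j) (h k)}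
          \<le> u * card (?TY \<times> ?TZ)"
        by (rule card_pairs_le[OF _ _ _ sub]) (use fin fT A0 in auto)
      then show "card {q \<in> M \<times> ?TY \<times> ?TZ. \<exists>x\<in>X. case q of (m, g, h) \<Rightarrow> \<forall>j<s. \<forall>k<s. G m x (g j) (h k)}
          \<le> u * (?Y ^ s * ?Z ^ s)"
        by (simp add: card_cartesian_product card_tuples)
      have "card S2 = card {(q, x) \<in> (M \<times> ?TY \<times> ?TZ) \<times> X.
          case q of (m, g, h) \<Rightarrow> \<forall>j<s. \<forall>k<s. G m x (g j) (h k)}"
        unfolding S2_def
        by (rule bij_betw_same_card[of "\<lambda>((m, x, h), g). ((m, g, h), x)"],
            rule bij_betwI[where g = "\<lambda>((m, g, h), x). ((m, x, h), g)"]) auto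
      then show "(e ^ s) ^ s * (u * (?Y ^ s * ?Z ^ s)) * card X
        \<le> card {(q, x) \<in> (M \<times> ?TY \<times> ?TZ) \<times> X. case q of (m, g, h) \<Rightarrow> \<forall>j<s. \<forall>k<s. G m x (g j) (h k)}"
        using c2 by (simp add: mult_ac)
    qed (use fin fT \<open>0 \<le> e\<close> \<open>0 < s\<close> in auto)
    then show ?thesis by simp
  qed
  \<comment> \<open>Up to reordering, each of \<open>BX\<close>, \<open>BY\<close>,
    \<open>BZ\<close> contains all grids with a repetition in one direction; of the grid conditions
    it keeps only one line, through the first entries of the other two tuples.\<close>
  define K where "K = u * ?X ^ s * ?Y ^ s * ?Z ^ s"
  define BX where "BX = {(m, p) \<in> M \<times> (?TY \<times> ?TZ). A m (fst p 0) (snd p 0)} \<times> {f \<in> ?TX. \<not> inj_on f {..<s}}"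
  define BY where "BY = {(m, p) \<in> M \<times> (?TX \<times> ?TZ). B m (fst p 0) (snd p 0)} \<times> {f \<in> ?TY. \<not> inj_on f {..<s}}"
  define BZ where "BZ = {(m, p) \<in> M \<times> (?TX \<times> ?TY). C m (fst p 0) (snd p 0)} \<times> {f \<in> ?TZ. \<not> inj_on f {..<s}}"
  have "K > 0" using \<open>0 < u\<close> \<open>0 < N\<close> N by (simp add: K_def)
  have bx: "card BX \<le> (real s)\<^sup>2 / N * K"
  proof -
    have "card BX \<le> (real s)\<^sup>2 / N * (u * card (?TY \<times> ?TZ) * card X ^ s)"
      unfolding BX_def
      by (rule card_noninj_times_le) (use fin fT A0 N \<open>0 < N\<close> \<open>0 < u\<close> in auto)
    then show ?thesis by (simp add: K_def card_cartesian_product card_tuples mult_ac)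
  qed
  have by': "card BY \<le> (real s)\<^sup>2 / N * K"
  proof -
    have "card BY \<le> (real s)\<^sup>2 / N * (u * card (?TX \<times> ?TZ) * card Y ^ s)"
      unfolding BY_def
      by (rule card_noninj_times_le) (use fin fT B0 N \<open>0 < N\<close> \<open>0 < u\<close> in auto)
    then show ?thesis by (simp add: K_def card_cartesian_product card_tuples mult_ac)
  qed
  have bz: "card BZ \<le> (real s)\<^sup>2 / N * K"
  proof -
    have "card BZ \<le> (real s)\<^sup>2 / N * (u * card (?TX \<times> ?TY) * card Z ^ s)"
      unfolding BZ_def
      by (rule card_noninj_times_le) (use fin fT C0 N \<open>0 < N\<close> \<open>0 < u\<close> in auto)
    then show ?thesis by (simp add: K_def card_cartesian_product card_tuples mult_ac)
  qed
  have finB: "finite BX" "finite BY" "finite BZ"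
    by (rule finite_subset[of _ "(M \<times> ?TY \<times> ?TZ) \<times> ?TX"], use fin fT in \<open>auto simp: BX_def\<close>)
       (rule finite_subset[of _ "(M \<times> ?TX \<times> ?TZ) \<times> ?TY"], use fin fT in \<open>auto simp: BY_def\<close>,
        rule finite_subset[of _ "(M \<times> ?TX \<times> ?TY) \<times> ?TZ"], use fin fT in \<open>auto simp: BZ_def\<close>)
  define BY' where "BY' = (\<lambda>((m, f, h), g). ((m, g, h), f)) ` BY"
  define BZ' where "BZ' = (\<lambda>((m, f, g), h). ((m, g, h), f)) ` BZ"
  have "card (BX \<union> BY' \<union> BZ') \<le> card BX + card BY' + card BZ'"
    by (meson card_Un_le add_le_mono1 le_trans)
  also have "\<dots> \<le> card BX + card BY + card BZ"
    unfolding BY'_def BZ'_def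
    by (intro add_mono card_image_le order_refl finB)
  finally have "real (card (BX \<union> BY' \<union> BZ')) \<le> 3 * ((real s)\<^sup>2 / N * K)"
    using bx by' bz by linarith
  also have "\<dots> < e ^ (s ^ 3) * K"
    using big \<open>0 < N\<close> \<open>0 < K\<close> by (simp add: field_simps)
  also have "\<dots> = ((e ^ s) ^ s) ^ s * (u * (?Y ^ s * ?Z ^ s)) * ?X ^ s"
    by (simp add: K_def power_mult[symmetric] power3_eq_cube mult_ac)
  also have "\<dots> \<le> card S3" by (rule c3)
  finally have "card (BX \<union> BY' \<union> BZ') < card S3" by simp
  moreover have "finite (BX \<union> BY' \<union> BZ')" using finB by (simp add: BY'_def BZ'_def)
  ultimately have "\<not> S3 \<subseteq> BX \<union> BY' \<union> BZ'" by (metis card_mono not_le)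
  then obtain p where p: "p \<in> S3" "p \<notin> BX" "p \<notin> BY'" "p \<notin> BZ'" by blast
  obtain m g h f where p_eq: "p = ((m, g, h), f)" by (metis prod.exhaust)
  note in3 = p(1)[unfolded p_eq] and notin = p(2-4)[unfolded p_eq]
  have *: "m \<in> M" "f \<in> ?TX" "g \<in> ?TY" "h \<in> ?TZ"
    and all: "\<And>i j k. i < s \<Longrightarrow> j < s \<Longrightarrow> k < s \<Longrightarrow> G m (f i) (g j) (h k)"
    using in3 by (simp_all add: S3_def)
  have ABC: "A m (g 0) (h 0)" "B m (f 0) (h 0)" "C m (f 0) (g 0)"
    using G[OF all[of 0 0 0]] \<open>0 < s\<close> by auto
  have "inj_on f {..<s}" using notin(1) * ABC by (simp add: BX_def)
  moreover have "((m, f, h), g) \<notin> BY" "((m, f, g), h) \<notin> BZ"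
    using notin(2,3) by (force simp: BY'_def BZ'_def)+
  then have "inj_on g {..<s}" "inj_on h {..<s}"
    using * ABC by (simp_all add: BY_def BZ_def)
  ultimately show thesis using that * all by blast
qed

section \<open>Crowns in chains and grids\<close>

text \<open>Sorted by cardinality, the first \<open>t\<close> members of the chain serve as lower
  elements and the next \<open>t\<close> as upper ones; every relation of the crown then
  holds.\<close>

lemma crown_of_chain:
  assumes C: "C \<subseteq> F" "finite C" "2 * t \<le> card C"
    and chain: "\<And>A B. A \<in> C \<Longrightarrow> B \<in> C \<Longrightarrow> A \<subseteq> B \<or> B \<subseteq> A"
    and fin: "\<And>A. A \<in> C \<Longrightarrow> finite A"
  shows "weak_subposet (crown_carrier t) (crown_le t) F (\<subseteq>)"
proof -
  obtain ys where ys: "set ys = C" "distinct ys" using finite_distinct_list[OF C(2)] by blast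
  define xs where "xs = sort_key card ys"
  have xs: "set xs = C" "distinct xs" "length xs = card C" "sorted (map card xs)"
    using ys by (simp_all add: xs_def flip: distinct_card)
  have mono: "xs ! i \<subseteq> xs ! j" if "i \<le> j" "j < card C" for i j
  proof -
    have mem: "xs ! i \<in> C" "xs ! j \<in> C" using that xs by (metis nth_mem order_le_less_trans)+
    have "card (xs ! i) \<le> card (xs ! j)"
      using sorted_nth_mono[OF xs(4), of i j] that xs(3) by simp
    then show ?thesis using chain[OF mem] fin mem by (metis card_seteq)
  qed
  define f where "f = (\<lambda>(b, i). xs ! (if b then t + i else i))"
  have idx: "(if b then t + i else i) < length xs" if "i < t" for b i
    using that C(3) xs(3) by auto
  have "inj_on f (crown_carrier t)"
    using xs(2) idx by (fastforce simp: inj_on_def f_def crown_carrier_def nth_eq_iff_index_eq)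
  moreover have "f ` crown_carrier t \<subseteq> F"
  proof (rule image_subsetI)
    fix p assume "p \<in> crown_carrier t"
    then obtain b i where p: "p = (b, i)" "i < t" by (auto simp: crown_carrier_def)
    then have "f p \<in> set xs" using idx[of i b] by (simp add: f_def del: nth_mem) (metis nth_mem)
    then show "f p \<in> F" using xs(1) C(1) by auto
  qed
  moreover have "f u \<subseteq> f v" if "u \<in> crown_carrier t" "v \<in> crown_carrier t" "crown_le t u v" for u v
  proof (cases "u = v")
    case False
    then have "fst u = False" "fst v = True" "snd u < t" "snd v < t"
      using that unfolding crown_le_def crown_carrier_def by auto
    then obtain i j where "u = (False, i)" "v = (True, j)" "i < t" "j < t"
      by (metis prod.collapse)
    then show ?thesis using mono[of i "t + j"] C(3) by (simp add: f_def)
  qed simp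
  ultimately show ?thesis unfolding weak_subposet_def by blast
qed

text \<open>The walk alternates between the first two coordinates, from \<open>(0, 0, 0)\<close> up to \<open>(m, m - 1, 0)\<close>, and
  then closes up through \<open>(m, m - 1, 1)\<close>, \<open>(0, m - 1, 1)\<close>, \<open>(0, 0, 1)\<close>. The line with index \<open>i\<close>, in which
  \<^const>\<open>None\<close> marks the free coordinate, joins the points with indices \<open>i - 1\<close> and \<open>i\<close>.\<close>

definition closed_walk :: "nat \<Rightarrow> nat \<Rightarrow> nat \<times> nat \<times> nat" where
  "closed_walk m i = (if i < 2 * m + 1 then (i + 1) div 2 else 0,
     if i < 2 * m then i div 2 else if i < 2 * m + 2 then m - 1 else 0,
     if i < 2 * m then 0 else 1)"

definition walk_line :: "nat \<Rightarrow> nat \<Rightarrow> nat option \<times> nat option \<times> nat option" where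
  "walk_line m i = (case closed_walk m i of (a, b, c) \<Rightarrow>
     if i = 0 \<or> i = 2 * m then (Some a, Some b, None)
     else if i = 2 * m + 2 \<or> i < 2 * m \<and> even i then (Some a, None, Some c)
     else (None, Some b, Some c))"

text \<open>On the staircase part of the walk these two quotients are the second and the first
  coordinate, so a point there reveals its index.\<close>

lemma eq_of_div2_eq:
  fixes i j :: nat
  assumes "i div 2 = j div 2" "Suc i div 2 = Suc j div 2"
  shows "i = j"
  using assms by (cases "even i"; cases "even j") (auto elim!: evenE oddE)

text \<open>\<open>2 \<le> m\<close> keeps \<open>(0, m - 1, 1)\<close> and \<open>(0, 0, 1)\<close>
  apart; this is the source of the bound 7 on the length \<open>2 * m + 3\<close>.\<close>

lemma closed_walk_inj:
  assumes "2 \<le> m" "i < 2 * m + 3" "j < 2 * m + 3" "closed_walk m i = closed_walk m j"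
  shows "i = j"
  using assms by (auto simp: closed_walk_def intro: eq_of_div2_eq split: if_splits)

lemma walk_line_inj:
  assumes "2 \<le> m" "i < 2 * m + 3" "j < 2 * m + 3" "walk_line m i = walk_line m j"
  shows "i = j"
  using assms
  by (auto simp: closed_walk_def walk_line_def Let_def elim!: oddE evenE split: if_splits)

definition opt_le :: "'a option \<Rightarrow> 'a \<Rightarrow> bool" where
  "opt_le x a \<longleftrightarrow> x = None \<or> x = Some a"

lemma walk_line_le:
  "case (walk_line m i, closed_walk m i) of ((x, y, z), (a, b, c)) \<Rightarrow> opt_le x a \<and> opt_le y b \<and> opt_le z c"
  by (auto simp: walk_line_def opt_le_def split: prod.splits)

lemma walk_line_Suc_le:
  assumes "2 \<le> m" "i < 2 * m + 3"
  shows "case (walk_line m ((i + 1) mod (2 * m + 3)), closed_walk m i) of ((x, y, z), (a, b, c)) \<Rightarrow>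
    opt_le x a \<and> opt_le y b \<and> opt_le z c"
proof (cases "i = 2 * m + 2")
  case True
  then have "(i + 1) mod (2 * m + 3) = 0" by (simp add: True numeral_3_eq_3)
  then show ?thesis using assms True by (simp add: walk_line_def closed_walk_def opt_le_def)
next
  case False
  then have "(i + 1) mod (2 * m + 3) = i + 1" using assms by simp
  \<comment> \<open>Cases by the step leaving point \<open>i\<close>: the two kinds of staircase
    steps, the ascent in the third coordinate, and the returns in the first and in the
    second.\<close>
  moreover consider "i + 1 < 2 * m" "odd i" | "i + 1 < 2 * m" "even i"
    | "i + 1 = 2 * m" | "i = 2 * m" | "i = 2 * m + 1" using False assms by linarith
  then have "case (walk_line m (i + 1), closed_walk m i) of ((x, y, z), (a, b, c)) \<Rightarrow>
    opt_le x a \<and> opt_le y b \<and> opt_le z c"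
    by cases (use assms in \<open>auto simp: walk_line_def closed_walk_def opt_le_def elim!: oddE evenE\<close>)
  ultimately show ?thesis by simp
qed


lemma closed_walk_le:
  assumes "i < 2 * m + 3" "closed_walk m i = (a, b, c)" "2 \<le> m"
  shows "a \<le> m" "b \<le> m" "c \<le> m"
  using assms by (auto simp: closed_walk_def split: if_splits)

text \<open>The free coordinate of a line contributes no block, so points and lines are sent to sets
  by the same union.\<close>

definition block_of :: "(nat \<Rightarrow> 'a set) \<Rightarrow> nat option \<Rightarrow> 'a set" where
  "block_of f x = (case x of None \<Rightarrow> {} | Some i \<Rightarrow> f i)"

lemma block_of_mono: "opt_le x a \<Longrightarrow> block_of f x \<subseteq> f a"
  by (auto simp: opt_le_def block_of_def)

lemma block_of_inj:
  assumes inj: "inj_on f {..m}" and ne: "\<And>i. i \<le> m \<Longrightarrow> f i \<noteq> {}"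
    and le: "\<And>i. x = Some i \<Longrightarrow> i \<le> m" "\<And>i. y = Some i \<Longrightarrow> i \<le> m"
    and eq: "block_of f x = block_of f y"
  shows "x = y"
proof (cases "x = None \<or> y = None")
  case True
  then show ?thesis using eq ne le by (cases x; cases y) (simp_all add: block_of_def, fastforce+)
next
  case False
  then obtain i j where "x = Some i" "y = Some j" by auto
  then show ?thesis using eq le inj by (simp add: block_of_def inj_on_eq_iff)
qed

text \<open>Points of the closed walk become the upper elements and its lines the lower ones; a line
  omits one block of each point on it. Intersecting with \<open>X\<close>, \<open>Y\<close>,
  \<open>Z\<close> recovers the blocks, and nonemptiness tells a missing block from a present
  one.\<close>

lemma crown_of_grid:
  fixes \<sigma> :: "'a \<Rightarrow> 'b" and W :: "'a set" and f g h :: "nat \<Rightarrow> 'a set"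
  assumes "2 \<le> m" "inj \<sigma>"
    and inj: "inj_on f {..m}" "inj_on g {..m}" "inj_on h {..m}"
    and ne: "\<And>i. i \<le> m \<Longrightarrow> f i \<noteq> {} \<and> g i \<noteq> {} \<and> h i \<noteq> {}"
    and sub: "\<And>i. i \<le> m \<Longrightarrow> f i \<subseteq> X \<and> g i \<subseteq> Y \<and> h i \<subseteq> Z"
    and disj: "X \<inter> Y = {}" "X \<inter> Z = {}" "Y \<inter> Z = {}" "W \<inter> (X \<union> Y \<union> Z) = {}"
    and points: "\<And>i j k. i \<le> m \<Longrightarrow> j \<le> m \<Longrightarrow> k \<le> m \<Longrightarrow> \<sigma> ` (W \<union> f i \<union> g j \<union> h k) \<in> F"
    and lines: "\<And>j k. j \<le> m \<Longrightarrow> k \<le> m \<Longrightarrow> \<sigma> ` (W \<union> g j \<union> h k) \<in> F"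
      "\<And>i k. i \<le> m \<Longrightarrow> k \<le> m \<Longrightarrow> \<sigma> ` (W \<union> f i \<union> h k) \<in> F"
      "\<And>i j. i \<le> m \<Longrightarrow> j \<le> m \<Longrightarrow> \<sigma> ` (W \<union> f i \<union> g j) \<in> F"
  shows "weak_subposet (crown_carrier (2 * m + 3)) (crown_le (2 * m + 3)) F (\<subseteq>)"
proof -
  let ?t = "2 * m + 3"
  define P where "P = (\<lambda>(x, y, z). \<sigma> ` (W \<union> block_of f x \<union> block_of g y \<union> block_of h z))"
  define top where "top i = (case closed_walk m i of (a, b, c) \<Rightarrow> (Some a, Some b, Some c))" for i
  define idx where "idx = (\<lambda>(b, i). if b then top i else walk_line m i)"
  define valid where "valid = {(x, y, z). \<forall>i. (x = Some i \<or> y = Some i \<or> z = Some i) \<longrightarrow> i \<le> m}"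
  have P_inj: "p = q" if "p \<in> valid" "q \<in> valid" "P p = P q" for p q
  proof -
    obtain x y z x' y' z' where pq: "p = (x, y, z)" "q = (x', y', z')" by (metis prod.exhaust)
    have val: "\<And>i. x = Some i \<Longrightarrow> i \<le> m" "\<And>i. y = Some i \<Longrightarrow> i \<le> m" "\<And>i. z = Some i \<Longrightarrow> i \<le> m"
      "\<And>i. x' = Some i \<Longrightarrow> i \<le> m" "\<And>i. y' = Some i \<Longrightarrow> i \<le> m" "\<And>i. z' = Some i \<Longrightarrow> i \<le> m"
      using that by (auto simp: valid_def pq)
    have sub': "block_of f x \<subseteq> X" "block_of g y \<subseteq> Y" "block_of h z \<subseteq> Z"
      "block_of f x' \<subseteq> X" "block_of g y' \<subseteq> Y" "block_of h z' \<subseteq> Z"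
      using val sub by (auto simp: block_of_def split: option.splits)
    have eq: "W \<union> block_of f x \<union> block_of g y \<union> block_of h z = W \<union> block_of f x' \<union> block_of g y' \<union> block_of h z'"
      using that(3) \<open>inj \<sigma>\<close> by (simp add: P_def pq inj_image_eq_iff)
    have parts: "(W \<union> A \<union> B \<union> C) \<inter> X = A \<and> (W \<union> A \<union> B \<union> C) \<inter> Y = B \<and> (W \<union> A \<union> B \<union> C) \<inter> Z = C"
      if "A \<subseteq> X" "B \<subseteq> Y" "C \<subseteq> Z" for A B C
      using that disj by blast
    have "block_of f x = block_of f x'" "block_of g y = block_of g y'" "block_of h z = block_of h z'"
      using parts[OF sub'(1-3)] parts[OF sub'(4-6)] unfolding eq by auto
    then show ?thesis
      using block_of_inj[OF inj(1)] block_of_inj[OF inj(2)] block_of_inj[OF inj(3)] val ne pq by metis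
  qed
  have top_valid: "top i \<in> valid" and line_valid: "walk_line m i \<in> valid" if "i < ?t" for i
    using closed_walk_le[OF that _ \<open>2 \<le> m\<close>]
    by (auto simp: top_def walk_line_def valid_def split: prod.splits)
  have idx_valid: "idx u \<in> valid" if "u \<in> crown_carrier ?t" for u
    using that top_valid line_valid by (auto simp: idx_def crown_carrier_def split: prod.splits)
  have top_ne_line: "top i \<noteq> walk_line m j" for i j
    by (auto simp: top_def walk_line_def split: prod.splits)
  have top_inj: "i = j" if "i < ?t" "j < ?t" "top i = top j" for i j
    using closed_walk_inj[OF \<open>2 \<le> m\<close> that(1,2)] that(3) by (auto simp: top_def split: prod.splits)
  have idx_inj: "inj_on idx (crown_carrier ?t)"
  proof (rule inj_onI, clarify)
    fix b i b' i' assume *: "(b, i) \<in> crown_carrier ?t" "(b', i') \<in> crown_carrier ?t" "idx (b, i) = idx (b', i')"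
    then have lt: "i < ?t" "i' < ?t" by (auto simp: crown_carrier_def)
    show "b = b' \<and> i = i'"
      using *(3) lt top_inj[of i i'] walk_line_inj[OF \<open>2 \<le> m\<close> lt] top_ne_line top_ne_line[symmetric]
      by (cases b; cases b') (auto simp: idx_def)
  qed
  have "inj_on P valid" using P_inj by (rule inj_onI)
  then have "inj_on P (idx ` crown_carrier ?t)"
    by (rule inj_on_subset) (use idx_valid in blast)
  with idx_inj have "inj_on (P \<circ> idx) (crown_carrier ?t)" by (rule comp_inj_on)
  moreover have "(P \<circ> idx) ` crown_carrier ?t \<subseteq> F"
  proof (rule image_subsetI)
    fix u assume "u \<in> crown_carrier ?t"
    then obtain b i where u: "u = (b, i)" "i < ?t" by (auto simp: crown_carrier_def)
    obtain x y z where xyz: "closed_walk m i = (x, y, z)" by (metis prod.exhaust)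
    note le = closed_walk_le[OF u(2) xyz \<open>2 \<le> m\<close>]
    show "(P \<circ> idx) u \<in> F"
      using points[OF le] lines(1)[OF le(2,3)] lines(2)[OF le(1,3)] lines(3)[OF le(1,2)]
      by (auto simp: P_def idx_def u top_def xyz walk_line_def block_of_def)
  qed
  moreover have "(P \<circ> idx) u \<subseteq> (P \<circ> idx) v"
    if "u \<in> crown_carrier ?t" "v \<in> crown_carrier ?t" "crown_le ?t u v" for u v
  proof (cases "u = v")
    case False
    then have *: "fst u = False" "fst v = True" "snd v < ?t"
      "snd u = snd v \<or> snd u = (snd v + 1) mod ?t"
      using that unfolding crown_le_def crown_carrier_def by auto
    define i where "i = snd v"
    obtain a b c where abc: "closed_walk m i = (a, b, c)" by (metis prod.exhaust)
    obtain x y z where xyz: "walk_line m (snd u) = (x, y, z)" by (metis prod.exhaust)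
    have "opt_le x a \<and> opt_le y b \<and> opt_le z c"
      using *(4) walk_line_le[of m i] walk_line_Suc_le[OF \<open>2 \<le> m\<close>, of i] *(3) abc xyz
      by (auto simp: i_def[symmetric])
    then have "block_of f x \<subseteq> f a" "block_of g y \<subseteq> g b" "block_of h z \<subseteq> h c"
      by (simp_all add: block_of_mono)
    moreover have "idx u = (x, y, z)" "idx v = (Some a, Some b, Some c)"
      using *(1,2) abc xyz by (simp_all add: idx_def case_prod_beta top_def i_def)
    ultimately show ?thesis by (auto simp: P_def block_of_def)
  qed simp
  ultimately show ?thesis unfolding weak_subposet_def by blast
qed

section \<open>Random permutations of the ground set\<close>

text \<open>Sets of positions are mapped into the ground set by a random permutation; divided by \<open>n!\<close>, this
  is the probability that all position sets in \<open>\<J>\<close> land in \<open>F\<close>. The images of the initial segments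
  form a random maximal chain.\<close>

definition hits :: "nat \<Rightarrow> nat set set \<Rightarrow> nat set set \<Rightarrow> nat" where
  "hits n F \<J> = card {\<sigma>. \<sigma> permutes {1..n} \<and> (\<forall>J\<in>\<J>. \<sigma> ` J \<in> F)}"

lemma finite_perm_subset: "finite {\<sigma>. \<sigma> permutes {1..n::nat} \<and> P \<sigma>}"
  by (rule finite_subset[OF _ finite_permutations[of "{1..n}"]]) auto

lemma hits_antimono: "\<J> \<subseteq> \<J>' \<Longrightarrow> hits n F \<J>' \<le> hits n F \<J>"
  unfolding hits_def by (rule card_mono[OF finite_perm_subset]) blast

text \<open>Composing on the right with \<open>\<pi>\<close> is a bijection of the permutations, so
  \<open>hits\<close> sees position sets only up to symmetry.\<close>

lemma hits_image:
  assumes "\<pi> permutes {1..n}"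
  shows "hits n F ((`) \<pi> ` \<J>) = hits n F \<J>"
proof -
  have "bij_betw (\<lambda>\<sigma>. \<sigma> \<circ> \<pi>) {\<sigma>. \<sigma> permutes {1..n} \<and> (\<forall>J\<in>(`) \<pi> ` \<J>. \<sigma> ` J \<in> F)}
    {\<sigma>. \<sigma> permutes {1..n} \<and> (\<forall>J\<in>\<J>. \<sigma> ` J \<in> F)}"
  proof (rule bij_betwI[where g = "\<lambda>\<sigma>. \<sigma> \<circ> inv \<pi>"])
    show "(\<lambda>\<sigma>. \<sigma> \<circ> \<pi>) \<in> {\<sigma>. \<sigma> permutes {1..n} \<and> (\<forall>J\<in>(`) \<pi> ` \<J>. \<sigma> ` J \<in> F)} \<rightarrow>
      {\<sigma>. \<sigma> permutes {1..n} \<and> (\<forall>J\<in>\<J>. \<sigma> ` J \<in> F)}"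
      using assms by (auto simp: permutes_compose image_comp)
    show "(\<lambda>\<sigma>. \<sigma> \<circ> inv \<pi>) \<in> {\<sigma>. \<sigma> permutes {1..n} \<and> (\<forall>J\<in>\<J>. \<sigma> ` J \<in> F)} \<rightarrow>
      {\<sigma>. \<sigma> permutes {1..n} \<and> (\<forall>J\<in>(`) \<pi> ` \<J>. \<sigma> ` J \<in> F)}"
      using assms by (auto simp: permutes_compose permutes_inv image_comp permutes_inverses)
  qed (use assms in \<open>simp_all add: comp_assoc permutes_inv_o\<close>)
  then show ?thesis unfolding hits_def by (rule bij_betw_same_card)
qed

text \<open>Colour each element by the part containing it, with 0 outside all parts. Equal class
  sizes make the two multisets of colours equal, which yields a permutation respecting
  colours.\<close>

lemma obtain_permutation_4:
  fixes W X Y Z W' X' Y' Z' :: "'a set"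
  assumes "finite S"
    and sub: "W \<union> X \<union> Y \<union> Z \<subseteq> S" "W' \<union> X' \<union> Y' \<union> Z' \<subseteq> S"
    and disj: "W \<inter> X = {}" "W \<inter> Y = {}" "W \<inter> Z = {}" "X \<inter> Y = {}" "X \<inter> Z = {}" "Y \<inter> Z = {}"
    and disj': "W' \<inter> X' = {}" "W' \<inter> Y' = {}" "W' \<inter> Z' = {}" "X' \<inter> Y' = {}" "X' \<inter> Z' = {}" "Y' \<inter> Z' = {}"
    and card: "card W = card W'" "card X = card X'" "card Y = card Y'" "card Z = card Z'"
  obtains \<pi> where "\<pi> permutes S" "\<pi> ` W = W'" "\<pi> ` X = X'" "\<pi> ` Y = Y'" "\<pi> ` Z = Z'"
proof -
  define colour :: "'a set \<Rightarrow> 'a set \<Rightarrow> 'a set \<Rightarrow> 'a set \<Rightarrow> 'a \<Rightarrow> nat" where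
    "colour A B C D a = (if a \<in> A then 1 else if a \<in> B then 2 else if a \<in> C then 3
      else if a \<in> D then 4 else 0)" for A B C D a
  have classes: "{a \<in> S. colour A B C D a = 1} = A" "{a \<in> S. colour A B C D a = 2} = B"
    "{a \<in> S. colour A B C D a = 3} = C" "{a \<in> S. colour A B C D a = 4} = D"
    "{a \<in> S. colour A B C D a = 0} = S - (A \<union> B \<union> C \<union> D)"
    if "A \<union> B \<union> C \<union> D \<subseteq> S" "A \<inter> B = {}" "A \<inter> C = {}" "A \<inter> D = {}" "B \<inter> C = {}" "B \<inter> D = {}" "C \<inter> D = {}"
    for A B C D
    using that by (auto simp: colour_def split: if_splits)
  note cl = classes[OF sub(1) disj] and cl' = classes[OF sub(2) disj']
  have fin: "finite W" "finite X" "finite Y" "finite Z" "finite W'" "finite X'" "finite Y'" "finite Z'"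
    using sub \<open>finite S\<close> by (auto intro: finite_subset)
  have un: "card (W \<union> X \<union> Y \<union> Z) = card (W' \<union> X' \<union> Y' \<union> Z')"
    using fin disj disj' card by (simp add: card_Un_disjoint Int_Un_distrib2)
  have "card {a \<in> S. colour W X Y Z a = k} = card {a \<in> S. colour W' X' Y' Z' a = k}" for k
  proof -
    consider "k = 0" | "k = 1" | "k = 2" | "k = 3" | "k = 4" | "k > 4" by linarith
    then show ?thesis
    proof cases
      case 1
      then show ?thesis using cl cl' un sub fin by (simp add: card_Diff_subset)
    next
      case 6
      then have "{a \<in> S. colour W X Y Z a = k} = {}" "{a \<in> S. colour W' X' Y' Z' a = k} = {}"
        by (auto simp: colour_def)
      then show ?thesis by (simp only:)
    qed (simp_all only: cl cl' card)
  qed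
  then have "image_mset (colour W X Y Z) (mset_set S) = image_mset (colour W' X' Y' Z') (mset_set S)"
    using \<open>finite S\<close>
    by (intro multiset_eqI) (simp add: count_image_mset vimage_def Int_def conj_commute)
  then obtain \<pi> where \<pi>: "\<pi> permutes S" "\<forall>x\<in>S. colour W X Y Z x = colour W' X' Y' Z' (\<pi> x)"
    using image_mset_eq_implies_permutes[OF \<open>finite S\<close>] by metis
  have img: "\<pi> ` {a \<in> S. colour W X Y Z a = k} = {a \<in> S. colour W' X' Y' Z' a = k}" for k
  proof
    show "\<pi> ` {a \<in> S. colour W X Y Z a = k} \<subseteq> {a \<in> S. colour W' X' Y' Z' a = k}"
      using \<pi> permutes_in_image[OF \<pi>(1)] by auto
    show "{a \<in> S. colour W' X' Y' Z' a = k} \<subseteq> \<pi> ` {a \<in> S. colour W X Y Z a = k}"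
    proof
      fix b assume b: "b \<in> {a \<in> S. colour W' X' Y' Z' a = k}"
      then obtain a where "a \<in> S" "b = \<pi> a" using permutes_image[OF \<pi>(1)] by blast
      then show "b \<in> \<pi> ` {a \<in> S. colour W X Y Z a = k}" using b \<pi>(2) by auto
    qed
  qed
  show thesis using that[OF \<pi>(1)] img[of 1] img[of 2] img[of 3] img[of 4] unfolding cl cl' by blast
qed

text \<open>Only the sizes of the base \<open>W\<close> and of the three blocks matter, since a
  permutation of positions carries one configuration to the other. Empty parts give the one- and
  two-set versions below.\<close>

lemma hits_cong_4:
  assumes "W \<union> X \<union> Y \<union> Z \<subseteq> {1..n}" "W' \<union> X' \<union> Y' \<union> Z' \<subseteq> {1..n}"
    and "W \<inter> X = {}" "W \<inter> Y = {}" "W \<inter> Z = {}" "X \<inter> Y = {}" "X \<inter> Z = {}" "Y \<inter> Z = {}"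
    and "W' \<inter> X' = {}" "W' \<inter> Y' = {}" "W' \<inter> Z' = {}" "X' \<inter> Y' = {}" "X' \<inter> Z' = {}" "Y' \<inter> Z' = {}"
    and "card W = card W'" "card X = card X'" "card Y = card Y'" "card Z = card Z'"
  shows "hits n F {W \<union> X \<union> Y \<union> Z, W \<union> Y \<union> Z, W \<union> X \<union> Z, W \<union> X \<union> Y}
    = hits n F {W' \<union> X' \<union> Y' \<union> Z', W' \<union> Y' \<union> Z', W' \<union> X' \<union> Z', W' \<union> X' \<union> Y'}"
proof -
  obtain \<pi> where \<pi>: "\<pi> permutes {1..n}" "\<pi> ` W = W'" "\<pi> ` X = X'" "\<pi> ` Y = Y'" "\<pi> ` Z = Z'"
    by (rule obtain_permutation_4[OF _ assms]) simp
  show ?thesis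
    by (subst hits_image[OF \<pi>(1), symmetric]) (simp add: \<pi> image_Un)
qed

lemma hits_cong_1:
  assumes "J \<subseteq> {1..n}" "J' \<subseteq> {1..n}" "card J = card J'"
  shows "hits n F {J} = hits n F {J'}"
  using hits_cong_4[of J "{}" "{}" "{}" n J' "{}" "{}" "{}" F] assms by simp

lemma hits_cong_2:
  assumes "I \<subseteq> J" "J \<subseteq> {1..n}" "I' \<subseteq> J'" "J' \<subseteq> {1..n}" "card I = card I'" "card J = card J'"
  shows "hits n F {J, J - I} = hits n F {J', J' - I'}"
proof -
  have fin: "finite I" "finite J" "finite I'" "finite J'"
    using assms(1-4) finite_subset[OF _ finite_atLeastAtMost[of 1 n]] by blast+
  have "(J - I) \<union> I = J" "(J' - I') \<union> I' = J'" using assms by auto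
  then show ?thesis
    using hits_cong_4[of "J - I" I "{}" "{}" n "J' - I'" I' "{}" "{}" F] assms fin
    by (simp add: insert_commute card_Diff_subset Int_commute)
qed

text \<open>Double counting of permutations against \<open>k\<close>-sets sent into
  \<open>F\<close>: by symmetry all position sets of size \<open>k\<close> have equally many hits,
  and each permutation maps the \<open>k\<close>-sets bijectively onto the
  \<open>k\<close>-sets.\<close>

lemma hits_level:
  assumes F: "F \<subseteq> Pow {1..n}" and "k \<le> n"
  shows "(n choose k) * hits n F {{1..k}} = fact n * card {A \<in> F. card A = k}"
proof -
  let ?K = "{J. J \<subseteq> {1..n} \<and> card J = k}" and ?S = "{\<sigma>. \<sigma> permutes {1..n}}"
  have finK: "finite ?K" by (rule finite_subset[of _ "Pow {1..n}"]) auto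
  have finS: "finite ?S" by (simp add: finite_permutations)
  have "(n choose k) * hits n F {{1..k}} = (\<Sum>J\<in>?K. hits n F {{1..k}})"
    using n_subsets[of "{1..n}" k] by simp
  also have "\<dots> = (\<Sum>J\<in>?K. card {\<sigma> \<in> ?S. \<sigma> ` J \<in> F})"
  proof (rule sum.cong)
    fix J assume "J \<in> ?K"
    then have "hits n F {{1..k}} = hits n F {J}" using \<open>k \<le> n\<close> by (intro hits_cong_1) auto
    then show "hits n F {{1..k}} = card {\<sigma> \<in> ?S. \<sigma> ` J \<in> F}" by (simp add: hits_def)
  qed simp
  also have "\<dots> = (\<Sum>\<sigma>\<in>?S. card {J \<in> ?K. \<sigma> ` J \<in> F})"
    by (rule sum_multicount_gen[OF finK finS]) simp
  also have "\<dots> = (\<Sum>\<sigma>\<in>?S. card {A \<in> F. card A = k})"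
  proof (rule sum.cong)
    fix \<sigma> assume "\<sigma> \<in> ?S"
    then have \<sigma>: "\<sigma> permutes {1..n}" by simp
    have "bij_betw ((`) \<sigma>) {J \<in> ?K. \<sigma> ` J \<in> F} {A \<in> F. card A = k}"
    proof (rule bij_betwI[where g = "(`) (inv \<sigma>)"])
      show "(`) \<sigma> \<in> {J \<in> ?K. \<sigma> ` J \<in> F} \<rightarrow> {A \<in> F. card A = k}"
        using permutes_inj_on[OF \<sigma>] by (auto simp: card_image)
      show "(`) (inv \<sigma>) \<in> {A \<in> F. card A = k} \<rightarrow> {J \<in> ?K. \<sigma> ` J \<in> F}"
      proof
        fix A assume "A \<in> {A \<in> F. card A = k}"
        then have A: "A \<in> F" "A \<subseteq> {1..n}" "card A = k" using F by auto
        have "inv \<sigma> ` A \<subseteq> inv \<sigma> ` {1..n}" using A(2) by (rule image_mono)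
        also have "\<dots> = {1..n}" by (rule permutes_image[OF permutes_inv[OF \<sigma>]])
        finally show "inv \<sigma> ` A \<in> {J \<in> ?K. \<sigma> ` J \<in> F}"
          using A permutes_inj_on[OF permutes_inv[OF \<sigma>]] permutes_surj[OF \<sigma>]
          by (simp add: card_image image_f_inv_f)
      qed
    qed (use permutes_inj[OF \<sigma>] permutes_surj[OF \<sigma>] in \<open>simp_all add: image_inv_f_f image_f_inv_f\<close>)
    then show "card {J \<in> ?K. \<sigma> ` J \<in> F} = card {A \<in> F. card A = k}" by (rule bij_betw_same_card)
  qed simp
  also have "\<dots> = fact n * card {A \<in> F. card A = k}"
    by (simp add: card_permutations)
  finally show ?thesis .
qed

section \<open>Crowns from dense configurations of positions\<close>

text \<open>Blocks are taken from three disjoint intervals with \<open>v\<close> spare positions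
  each, so each direction has at least \<open>N\<close> of them. By symmetry every triple of blocks
  is as dense as \<open>I\<close>, \<open>J\<close>, \<open>K\<close>, and the grid lemma applies
  with permutations in the role of \<open>M\<close>.\<close>

lemma crown_of_dense_triple:
  fixes u e N :: real
  assumes m: "2 \<le> m"
    and I: "I \<union> J \<union> K \<subseteq> {1..b}" "I \<inter> J = {}" "I \<inter> K = {}" "J \<inter> K = {}"
    and ne: "I \<noteq> {}" "J \<noteq> {}" "K \<noteq> {}"
    and v: "b + 3 * v \<le> n"
    and le_u: "\<And>L. L \<in> {I, J, K} \<Longrightarrow> hits n F {{1..b - card L}} \<le> u"
    and dense: "e * u \<le> hits n F {{1..b}, {1..b} - I, {1..b} - J, {1..b} - K}"
    and "0 < u" "0 \<le> e" "0 < N"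
    and N: "\<And>L. L \<in> {I, J, K} \<Longrightarrow> N \<le> (card L + v) choose card L"
    and big: "3 * (real (Suc m))\<^sup>2 < e ^ (Suc m ^ 3) * N"
  shows "weak_subposet (crown_carrier (2 * m + 3)) (crown_le (2 * m + 3)) F (\<subseteq>)"
proof -
  define p q r where "p = card I" and "q = card J" and "r = card K"
  have fin: "finite I" "finite J" "finite K" using I(1) finite_subset[OF _ finite_atLeastAtMost[of 1 b]] by blast+
  have pos: "0 < p" "0 < q" "0 < r" using fin ne by (simp_all add: p_def q_def r_def card_gt_0_iff)
  have "card (I \<union> J \<union> K) = p + q + r"
    using fin I by (simp add: p_def q_def r_def card_Un_disjoint Int_Un_distrib2)
  then have pqr: "p + q + r \<le> b" using card_mono[OF _ I(1)] by simp
  \<comment> \<open>The size of \<open>W\<close> is chosen so that \<open>W\<close> with one block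
    from each interval has \<open>b\<close> elements; all the intervals together take
    \<open>b + 3 * v\<close> positions.\<close>
  define b0 where "b0 = b - (p + q + r)"
  define W where "W = {1..b0}"
  define X Y Z where "X = {b0 + 1..b0 + (p + v)}" and "Y = {b0 + (p + v) + 1..b0 + (p + v) + (q + v)}"
    and "Z = {b0 + (p + v) + (q + v) + 1..b0 + (p + v) + (q + v) + (r + v)}"
  have disj: "X \<inter> Y = {}" "X \<inter> Z = {}" "Y \<inter> Z = {}" "W \<inter> (X \<union> Y \<union> Z) = {}"
    by (auto simp: W_def X_def Y_def Z_def)
  have sub: "W \<union> X \<union> Y \<union> Z \<subseteq> {1..n}"
    using v pqr by (auto simp: W_def X_def Y_def Z_def b0_def)
  have finWXYZ: "finite W" "finite X" "finite Y" "finite Z"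
    by (simp_all add: W_def X_def Y_def Z_def)
  have cards: "card W = b0" "card X = p + v" "card Y = q + v" "card Z = r + v"
    by (simp_all add: W_def X_def Y_def Z_def)
  define \<X> \<Y> \<Z> where "\<X> = {x. x \<subseteq> X \<and> card x = p}" and "\<Y> = {x. x \<subseteq> Y \<and> card x = q}"
    and "\<Z> = {x. x \<subseteq> Z \<and> card x = r}"
  define G where "G \<sigma> x y z \<longleftrightarrow> \<sigma> ` (W \<union> x \<union> y \<union> z) \<in> F \<and> \<sigma> ` (W \<union> y \<union> z) \<in> F
    \<and> \<sigma> ` (W \<union> x \<union> z) \<in> F \<and> \<sigma> ` (W \<union> x \<union> y) \<in> F" for \<sigma> :: "nat \<Rightarrow> nat" and x y z
  define M where "M = {\<sigma>. \<sigma> permutes {1..n}}"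
  \<comment> \<open>A line lacks one block, of the size of \<open>L\<close>, so it lies in layer
    \<open>b - card L\<close>, whose hits are at most \<open>u\<close>.\<close>
  have line: "card {\<sigma> \<in> M. \<sigma> ` (W \<union> x \<union> y) \<in> F} \<le> u"
    if "x \<subseteq> {1..n}" "y \<subseteq> {1..n}" "W \<inter> x = {}" "W \<inter> y = {}" "x \<inter> y = {}"
      and L: "L \<in> {I, J, K}" "b0 + card x + card y = b - card L" for x y L
  proof -
    have "finite x" "finite y" using that(1,2) finite_subset[OF _ finite_atLeastAtMost[of 1 n]] by blast+
    then have "card (W \<union> x \<union> y) = b0 + card x + card y"
      using that finWXYZ cards by (simp add: card_Un_disjoint Int_Un_distrib2)
    then have "hits n F {W \<union> x \<union> y} = hits n F {{1..b - card L}}"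
      using L that(1,2) sub v by (intro hits_cong_1) auto
    then show ?thesis using le_u[OF L(1)] by (simp add: hits_def M_def)
  qed
  have X: "x \<subseteq> {1..n}" "W \<inter> x = {}" "card x = p" "x \<subseteq> X" "x \<noteq> {}" if "x \<in> \<X>" for x
    using that sub disj pos by (auto simp: \<X>_def)
  have Y: "x \<subseteq> {1..n}" "W \<inter> x = {}" "card x = q" "x \<subseteq> Y" "x \<noteq> {}" if "x \<in> \<Y>" for x
    using that sub disj pos by (auto simp: \<Y>_def)
  have Z: "x \<subseteq> {1..n}" "W \<inter> x = {}" "card x = r" "x \<subseteq> Z" "x \<noteq> {}" if "x \<in> \<Z>" for x
    using that sub disj pos by (auto simp: \<Z>_def)
  have XY: "x \<inter> y = {}" if "x \<in> \<X>" "y \<in> \<Y>" for x y using X(4)[OF that(1)] Y(4)[OF that(2)] disj by blast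
  have XZ: "x \<inter> y = {}" if "x \<in> \<X>" "y \<in> \<Z>" for x y using X(4)[OF that(1)] Z(4)[OF that(2)] disj by blast
  have YZ: "x \<inter> y = {}" if "x \<in> \<Y>" "y \<in> \<Z>" for x y using Y(4)[OF that(1)] Z(4)[OF that(2)] disj by blast
  obtain \<sigma> f g h where grid: "\<sigma> \<in> M" "f \<in> tuples (Suc m) \<X>" "g \<in> tuples (Suc m) \<Y>" "h \<in> tuples (Suc m) \<Z>"
    "inj_on f {..<Suc m}" "inj_on g {..<Suc m}" "inj_on h {..<Suc m}"
    "\<And>i j k. i < Suc m \<Longrightarrow> j < Suc m \<Longrightarrow> k < Suc m \<Longrightarrow> G \<sigma> (f i) (g j) (h k)"
  proof (rule exists_injective_grid[where M = M and X = \<X> and Y = \<Y> and Z = \<Z> and G = G and u = u and e = e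
        and N = N and s = "Suc m" and A = "\<lambda>\<sigma> y z. \<sigma> ` (W \<union> y \<union> z) \<in> F"
        and B = "\<lambda>\<sigma> x z. \<sigma> ` (W \<union> x \<union> z) \<in> F" and C = "\<lambda>\<sigma> x y. \<sigma> ` (W \<union> x \<union> y) \<in> F"])
    show "finite M" by (simp add: M_def finite_permutations)
    show "finite \<X>" "finite \<Y>" "finite \<Z>" using finWXYZ by (simp_all add: \<X>_def \<Y>_def \<Z>_def)
    show "N \<le> card \<X>" "N \<le> card \<Y>" "N \<le> card \<Z>"
      using N finWXYZ cards n_subsets[of X p] n_subsets[of Y q] n_subsets[of Z r]
      by (simp_all add: \<X>_def \<Y>_def \<Z>_def p_def q_def r_def)
    show "card {\<sigma> \<in> M. \<sigma> ` (W \<union> y \<union> z) \<in> F} \<le> u" if "y \<in> \<Y>" "z \<in> \<Z>" for y z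
      using Y[OF that(1)] Z[OF that(2)] YZ[OF that] pqr by (intro line[of y z I]) (auto simp: p_def b0_def)
    show "card {\<sigma> \<in> M. \<sigma> ` (W \<union> x \<union> z) \<in> F} \<le> u" if "x \<in> \<X>" "z \<in> \<Z>" for x z
      using X[OF that(1)] Z[OF that(2)] XZ[OF that] pqr by (intro line[of x z J]) (auto simp: q_def b0_def)
    show "card {\<sigma> \<in> M. \<sigma> ` (W \<union> x \<union> y) \<in> F} \<le> u" if "x \<in> \<X>" "y \<in> \<Y>" for x y
      using X[OF that(1)] Y[OF that(2)] XY[OF that] pqr by (intro line[of x y K]) (auto simp: r_def b0_def)
    show "e * u \<le> card {\<sigma> \<in> M. G \<sigma> x y z}" if xyz: "x \<in> \<X>" "y \<in> \<Y>" "z \<in> \<Z>" for x y z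
    proof -
      \<comment> \<open>The original configuration is completed to a partition of
        \<open>{1..b}\<close> with the same four sizes as \<open>W\<close>, \<open>x\<close>,
        \<open>y\<close>, \<open>z\<close>.\<close>
      define W' where "W' = {1..b} - (I \<union> J \<union> K)"
      have eqs: "W' \<union> I \<union> J \<union> K = {1..b}" "W' \<union> J \<union> K = {1..b} - I" "W' \<union> I \<union> K = {1..b} - J"
        "W' \<union> I \<union> J = {1..b} - K" "({1..b} - K) \<union> K = {1..b}"
        using I by (auto simp: W'_def)
      have "card W' = b0"
        using \<open>card (I \<union> J \<union> K) = p + q + r\<close> I(1) fin by (simp add: W'_def b0_def card_Diff_subset)
      have "hits n F {W \<union> x \<union> y \<union> z, W \<union> y \<union> z, W \<union> x \<union> z, W \<union> x \<union> y}
        = hits n F {W' \<union> I \<union> J \<union> K, W' \<union> J \<union> K, W' \<union> I \<union> K, W' \<union> I \<union> J}"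
      proof (rule hits_cong_4)
        show "W \<union> x \<union> y \<union> z \<subseteq> {1..n}" using X(1) Y(1) Z(1) xyz sub by simp
        show "W' \<union> I \<union> J \<union> K \<subseteq> {1..n}" unfolding eqs(1) using v by auto
        show "card W = card W'" using \<open>card W' = b0\<close> cards by simp
        show "card x = card I" "card y = card J" "card z = card K"
          using X(3) Y(3) Z(3) xyz by (simp_all add: p_def q_def r_def)
        show "W' \<inter> I = {}" "W' \<inter> J = {}" "W' \<inter> K = {}" by (auto simp: W'_def)
      qed (use X(2) Y(2) Z(2) XY XZ YZ xyz I in simp_all)
      also have "\<dots> = hits n F {{1..b}, {1..b} - I, {1..b} - J, {1..b} - K}"
        by (simp only: eqs)
      finally show ?thesis using dense by (simp add: hits_def G_def M_def)
    qed
  qed (use assms in \<open>simp_all add: G_def\<close>)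
  have in_range: "f i \<in> \<X>" "g i \<in> \<Y>" "h i \<in> \<Z>" if "i \<le> m" for i
    using grid(2-4) that by (auto simp: PiE_iff)
  show ?thesis
  proof (rule crown_of_grid[where f = f and g = g and h = h and W = W and \<sigma> = \<sigma>])
    show "inj \<sigma>" using grid(1) permutes_inj by (auto simp: M_def)
    show "inj_on f {..m}" "inj_on g {..m}" "inj_on h {..m}"
      using grid(5-7) by (simp_all add: lessThan_Suc_atMost)
    fix i assume i: "i \<le> m"
    show "f i \<noteq> {} \<and> g i \<noteq> {} \<and> h i \<noteq> {}" "f i \<subseteq> X \<and> g i \<subseteq> Y \<and> h i \<subseteq> Z"
      using X(4,5)[OF in_range(1)[OF i]] Y(4,5)[OF in_range(2)[OF i]] Z(4,5)[OF in_range(3)[OF i]]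
      by simp_all
  next
    fix i j k assume "i \<le> m" "j \<le> m" "k \<le> m"
    then have "G \<sigma> (f i) (g j) (h k)" using grid(8) by simp
    then show "\<sigma> ` (W \<union> f i \<union> g j \<union> h k) \<in> F" by (simp add: G_def)
  next
    fix i j assume ij: "i \<le> m" "j \<le> m"
    show "\<sigma> ` (W \<union> g i \<union> h j) \<in> F" using grid(8)[of 0 i j] ij by (simp add: G_def)
    show "\<sigma> ` (W \<union> f i \<union> h j) \<in> F" using grid(8)[of i 0 j] ij by (simp add: G_def)
    show "\<sigma> ` (W \<union> f i \<union> g j) \<in> F" using grid(8)[of i j 0] ij by (simp add: G_def)
  qed (use m disj in simp_all)
qed

text \<open>Disjointness of the three blocks is what the \<open>R\<close> parallel chains buy: the events that different
  chains meet \<open>F\<close> may be strongly dependent, but on average at least three of them occur.\<close>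
lemma dense_triple_of_pairs:
  fixes c :: real
  assumes free: "\<not> weak_subposet (crown_carrier t) (crown_le t) F (\<subseteq>)" and "0 < t"
    and b: "b \<le> n" "R * w \<le> b" and D: "D \<subseteq> {1..w}"
    and pairs: "c * hits n F {{1..b}} \<le> (\<Sum>d\<in>D. hits n F {{1..b}, {1..b - d}})"
    and pos: "0 < hits n F {{1..b}}" and R: "6 * real t \<le> R * c"
  obtains I J K where "I \<union> J \<union> K \<subseteq> {1..b}" "I \<inter> J = {}" "I \<inter> K = {}" "J \<inter> K = {}"
    "card I \<in> D" "card J \<in> D" "card K \<in> D"
    "hits n F {{1..b}} \<le> real R ^ 4 * real (card D) ^ 3 * hits n F {{1..b}, {1..b} - I, {1..b} - J, {1..b} - K}"
proof -
  define B where "B = {1..b}"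
  \<comment> \<open>The first \<open>d\<close> positions of the \<open>i\<close>-th window of width
    \<open>w\<close>. For fixed \<open>i\<close> the sets \<open>B - I i d\<close> descend from
    \<open>B\<close> as \<open>d\<close> grows: the \<open>i\<close>-th chain.\<close>
  define I where "I i d = {i * w + 1..i * w + d}" for i d :: nat
  define S where "S = {\<sigma>. \<sigma> permutes {1..n} \<and> \<sigma> ` B \<in> F}"
  define hit where "hit \<sigma> i d \<longleftrightarrow> \<sigma> ` (B - I i d) \<in> F" for \<sigma> :: "nat \<Rightarrow> nat" and i d
  have finS: "finite S" unfolding S_def by (rule finite_perm_subset)
  have finD: "finite D" using D finite_subset by blast
  have cardS: "hits n F {B} = card S" by (simp add: hits_def S_def)
  have I_sub: "I i d \<subseteq> B" if "i < R" "d \<in> D" for i d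
  proof -
    have "(i + 1) * w \<le> R * w" using that by (intro mult_right_mono) auto
    then have "i * w + w \<le> b" using b by simp
    moreover have "d \<le> w" using that D by auto
    ultimately show ?thesis by (auto simp: I_def B_def)
  qed
  have I_card: "card (I i d) = d" for i d by (simp add: I_def)
  have I_disj: "I i d \<inter> I j d' = {}" if "i \<noteq> j" "d \<in> D" "d' \<in> D" for i j d d'
  proof -
    have "d \<le> w" "d' \<le> w" using that D by auto
    moreover have "(i + 1) * w \<le> j * w \<or> (j + 1) * w \<le> i * w"
      using that by (metis Suc_eq_plus1 mult_le_mono1 not_less_eq_eq nat_le_linear le_antisym)
    ultimately show ?thesis by (auto simp: I_def)
  qed
  \<comment> \<open>More than \<open>2 * t\<close> hits on one chain would themselves form a chain
    in \<open>F\<close> containing the crown.\<close>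
  have few: "card {d \<in> D. hit \<sigma> i d} \<le> 2 * t" if "\<sigma> \<in> S" "i < R" for \<sigma> i
  proof (rule ccontr)
    assume many: "\<not> card {d \<in> D. hit \<sigma> i d} \<le> 2 * t"
    define E where "E = {d \<in> D. hit \<sigma> i d}"
    have \<sigma>: "inj \<sigma>" using that(1) permutes_inj by (auto simp: S_def)
    have inj: "inj_on (\<lambda>d. \<sigma> ` (B - I i d)) E"
    proof (rule inj_onI)
      fix d d' assume *: "d \<in> E" "d' \<in> E" "\<sigma> ` (B - I i d) = \<sigma> ` (B - I i d')"
      then have "B - I i d = B - I i d'" using \<sigma> by (simp add: inj_image_eq_iff)
      moreover have "I i d \<subseteq> B" "I i d' \<subseteq> B" using I_sub that(2) * by (simp_all add: E_def)
      ultimately have "I i d = I i d'" by blast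
      then show "d = d'" using I_card by metis
    qed
    have "weak_subposet (crown_carrier t) (crown_le t) F (\<subseteq>)"
    proof (rule crown_of_chain)
      show "(\<lambda>d. \<sigma> ` (B - I i d)) ` E \<subseteq> F" by (auto simp: E_def hit_def)
      show "finite ((\<lambda>d. \<sigma> ` (B - I i d)) ` E)" using finD by (simp add: E_def)
      show "2 * t \<le> card ((\<lambda>d. \<sigma> ` (B - I i d)) ` E)" using many inj by (simp add: card_image E_def)
    next
      fix A A' assume "A \<in> (\<lambda>d. \<sigma> ` (B - I i d)) ` E" "A' \<in> (\<lambda>d. \<sigma> ` (B - I i d)) ` E"
      then obtain d d' where "A = \<sigma> ` (B - I i d)" "A' = \<sigma> ` (B - I i d')" by blast
      moreover have "I i d \<subseteq> I i d' \<or> I i d' \<subseteq> I i d" by (auto simp: I_def)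
      ultimately show "A \<subseteq> A' \<or> A' \<subseteq> A" by blast
    qed (auto simp: B_def)
    then show False using free by blast
  qed
  define T where "T = {(i, j, k). i < R \<and> j < R \<and> k < R \<and> i \<noteq> j \<and> i \<noteq> k \<and> j \<noteq> k}"
  define T3 where "T3 = T \<times> D \<times> D \<times> D"
  have T_sub: "T \<subseteq> {..<R} \<times> {..<R} \<times> {..<R}" by (auto simp: T_def)
  have finT: "finite T" using T_sub finite_subset by blast
  have "card T \<le> R ^ 3" using card_mono[OF _ T_sub] by (simp add: power3_eq_cube)
  then have cardT3: "card T3 \<le> R ^ 3 * card D ^ 3"
    by (simp add: T3_def power3_eq_cube card_cartesian_product)
  have finT3: "finite T3" using finT finD by (simp add: T3_def)
  define tri where "tri \<sigma> p \<longleftrightarrow> (case p of ((i, j, k), d1, d2, d3) \<Rightarrow> hit \<sigma> i d1 \<and> hit \<sigma> j d2 \<and> hit \<sigma> k d3)"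
    for \<sigma> p
  \<comment> \<open>The active chains, those meeting \<open>F\<close> below \<open>B\<close>. If
    there are more than two, some triple is counted, and the factor \<open>R\<close> then covers the
    number of all of them.\<close>
  define act where "act \<sigma> = {i. i < R \<and> (\<exists>d\<in>D. hit \<sigma> i d)}" for \<sigma>
  have act_le: "card (act \<sigma>) \<le> 2 + R * card {p \<in> T3. tri \<sigma> p}" for \<sigma>
  proof (cases "card (act \<sigma>) \<le> 2")
    case False
    have "act \<sigma> \<subseteq> {..<R}" by (auto simp: act_def)
    then have fin: "finite (act \<sigma>)" and le: "card (act \<sigma>) \<le> R"
      using finite_subset card_mono[of "{..<R}" "act \<sigma>"] by auto
    obtain A where "A \<subseteq> act \<sigma>" "card A = 3"
      using obtain_subset_with_card_n[of 3 "act \<sigma>"] False by (metis not_less_eq_eq numeral_2_eq_2 numeral_3_eq_3)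
    then obtain i j k where ijk: "i \<in> act \<sigma>" "j \<in> act \<sigma>" "k \<in> act \<sigma>" "i \<noteq> j" "i \<noteq> k" "j \<noteq> k"
      by (auto simp: card_3_iff)
    then obtain d1 d2 d3 where "d1 \<in> D" "hit \<sigma> i d1" "d2 \<in> D" "hit \<sigma> j d2" "d3 \<in> D" "hit \<sigma> k d3"
      by (auto simp: act_def)
    then have "((i, j, k), d1, d2, d3) \<in> {p \<in> T3. tri \<sigma> p}"
      using ijk by (simp add: T3_def T_def tri_def act_def)
    then have "{p \<in> T3. tri \<sigma> p} \<noteq> {}" by blast
    then have "1 \<le> card {p \<in> T3. tri \<sigma> p}" using finT3 by (simp add: Suc_leI card_gt_0_iff)
    then have "R * 1 \<le> R * card {p \<in> T3. tri \<sigma> p}" by (rule mult_le_mono2)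
    then show ?thesis using le by linarith
  qed simp
  have blocks: "hits n F {B, B - I i d} = hits n F {{1..b}, {1..b - d}}" if "i < R" "d \<in> D" for i d
  proof -
    have "d \<le> b" using I_sub[OF that] card_mono[of B "I i d"] by (simp add: I_card B_def)
    then have "{1..b} - {b - d + 1..b} = {1..b - d}" by auto
    moreover have "hits n F {B, B - I i d} = hits n F {{1..b}, {1..b} - {b - d + 1..b}}"
      by (rule hits_cong_2) (use I_sub[OF that] b(1) \<open>d \<le> b\<close> in \<open>auto simp: B_def I_card\<close>)
    ultimately show ?thesis by simp
  qed
  \<comment> \<open>By symmetry every chain satisfies \<open>pairs\<close>. Summing the hits over
    all \<open>R\<close> chains and dividing by the at most \<open>2 * t\<close> on each bounds the
    average number of active chains from below.\<close>
  have "R * (c * card S) \<le> real R * real (\<Sum>d\<in>D. hits n F {{1..b}, {1..b - d}})"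
    using pairs cardS by (intro mult_left_mono) (simp_all add: B_def)
  also have "\<dots> = real (\<Sum>i<R. \<Sum>d\<in>D. card {\<sigma> \<in> S. hit \<sigma> i d})"
  proof -
    have "card {\<sigma> \<in> S. hit \<sigma> i d} = hits n F {B, B - I i d}" for i d
      by (simp add: hits_def S_def hit_def conj_assoc)
    then have "(\<Sum>i<R. \<Sum>d\<in>D. card {\<sigma> \<in> S. hit \<sigma> i d}) = (\<Sum>i<R. \<Sum>d\<in>D. hits n F {{1..b}, {1..b - d}})"
      using blocks by simp
    then show ?thesis by simp
  qed
  also have "(\<Sum>i<R. \<Sum>d\<in>D. card {\<sigma> \<in> S. hit \<sigma> i d}) = (\<Sum>\<sigma>\<in>S. \<Sum>i<R. card {d \<in> D. hit \<sigma> i d})"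
    by (subst sum.swap) (intro sum.cong refl sum_multicount_gen[OF _ _ ballI], simp_all add: finS finD)
  also have "real \<dots> \<le> real (\<Sum>\<sigma>\<in>S. 2 * t * card (act \<sigma>))"
  proof (intro of_nat_mono sum_mono)
    fix \<sigma> assume \<sigma>: "\<sigma> \<in> S"
    have "(\<Sum>i<R. card {d \<in> D. hit \<sigma> i d}) = (\<Sum>i\<in>act \<sigma>. card {d \<in> D. hit \<sigma> i d})"
      by (rule sum.mono_neutral_right) (auto simp: act_def card_gt_0_iff)
    also have "\<dots> \<le> (\<Sum>i\<in>act \<sigma>. 2 * t)"
      using few[OF \<sigma>] by (intro sum_mono) (auto simp: act_def)
    finally show "(\<Sum>i<R. card {d \<in> D. hit \<sigma> i d}) \<le> 2 * t * card (act \<sigma>)" by (simp add: mult.commute)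
  qed
  also have "\<dots> \<le> real (\<Sum>\<sigma>\<in>S. 2 * t * (2 + R * card {p \<in> T3. tri \<sigma> p}))"
    using act_le by (intro of_nat_mono sum_mono mult_left_mono) auto
  also have "(\<Sum>\<sigma>\<in>S. 2 * t * (2 + R * card {p \<in> T3. tri \<sigma> p})) = 2 * t * (2 * card S + R * (\<Sum>\<sigma>\<in>S. card {p \<in> T3. tri \<sigma> p}))"
    by (simp only: sum.distrib sum_distrib_left[symmetric] sum_constant) (simp add: algebra_simps)
  finally have "R * (c * card S) \<le> 2 * real t * (2 * real (card S) + real R * real (\<Sum>\<sigma>\<in>S. card {p \<in> T3. tri \<sigma> p}))"
    by simp
  \<comment> \<open>The choice of \<open>R\<close> makes this average at least 3, so after the 2
    allowed by \<open>act_le\<close> a positive share remains for the triples.\<close>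
  moreover have "6 * real t * card S \<le> R * c * card S" using R by (intro mult_right_mono) auto
  ultimately have "2 * real t * (3 * real (card S))
    \<le> 2 * real t * (2 * real (card S) + real R * real (\<Sum>\<sigma>\<in>S. card {p \<in> T3. tri \<sigma> p}))"
    by (simp add: mult.assoc)
  then have "real (card S) \<le> real R * real (\<Sum>\<sigma>\<in>S. card {p \<in> T3. tri \<sigma> p})"
    using \<open>0 < t\<close> by simp
  also have "(\<Sum>\<sigma>\<in>S. card {p \<in> T3. tri \<sigma> p}) = (\<Sum>p\<in>T3. card {\<sigma> \<in> S. tri \<sigma> p})"
    by (rule sum_multicount_gen) (simp_all add: finS finT3)
  finally have total: "real (card S) \<le> real R * real (\<Sum>p\<in>T3. card {\<sigma> \<in> S. tri \<sigma> p})" .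
  \<comment> \<open>Pigeonhole over at most \<open>R ^ 3 * card D ^ 3\<close> triples; the fourth
    factor \<open>R\<close> comes from \<open>act_le\<close>.\<close>
  have "\<exists>p\<in>T3. real (card S) \<le> real R ^ 4 * real (card D) ^ 3 * card {\<sigma> \<in> S. tri \<sigma> p}"
  proof (rule ccontr)
    assume "\<not> (\<exists>p\<in>T3. real (card S) \<le> real R ^ 4 * real (card D) ^ 3 * card {\<sigma> \<in> S. tri \<sigma> p})"
    then have small: "real R ^ 4 * real (card D) ^ 3 * card {\<sigma> \<in> S. tri \<sigma> p} < card S" if "p \<in> T3" for p
      using that by (meson not_le)
    have S0: "0 < card S" using pos cardS by (simp add: B_def)
    have "T3 \<noteq> {}" using total S0 by auto
    then have "R > 0" "card D > 0" using finD by (auto simp: T3_def T_def card_gt_0_iff)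
    have "real R ^ 3 * real (card D) ^ 3 * real (card S)
      \<le> real R ^ 3 * real (card D) ^ 3 * (real R * real (\<Sum>p\<in>T3. card {\<sigma> \<in> S. tri \<sigma> p}))"
      using total by (intro mult_left_mono) auto
    also have "\<dots> = (\<Sum>p\<in>T3. real R ^ 4 * real (card D) ^ 3 * card {\<sigma> \<in> S. tri \<sigma> p})"
      by (simp add: sum_distrib_left power4_eq_xxxx power3_eq_cube algebra_simps)
    also have "\<dots> < (\<Sum>p\<in>T3. real (card S))"
      using \<open>T3 \<noteq> {}\<close> finT3 small by (intro sum_strict_mono) auto
    also have "\<dots> = card T3 * real (card S)" by simp
    also have "\<dots> \<le> real (R ^ 3 * card D ^ 3) * real (card S)"
      using cardT3 by (intro mult_right_mono of_nat_mono) auto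
    finally show False by simp
  qed
  then obtain p where p: "p \<in> T3"
    "real (card S) \<le> real R ^ 4 * real (card D) ^ 3 * card {\<sigma> \<in> S. tri \<sigma> p}" by blast
  obtain i j k d1 d2 d3 where p_eq: "p = ((i, j, k), d1, d2, d3)" by (metis prod.exhaust)
  have T: "(i, j, k) \<in> T" "d1 \<in> D" "d2 \<in> D" "d3 \<in> D" using p(1) by (simp_all add: p_eq T3_def)
  note dense = p(2)[unfolded p_eq]
  have ijk: "i < R" "j < R" "k < R" "i \<noteq> j" "i \<noteq> k" "j \<noteq> k" using T by (auto simp: T_def)
  show thesis
  proof (rule that[of "I i d1" "I j d2" "I k d3"])
    show "I i d1 \<union> I j d2 \<union> I k d3 \<subseteq> {1..b}" using I_sub ijk T by (simp add: B_def)
    have "{\<sigma> \<in> S. tri \<sigma> ((i, j, k), d1, d2, d3)}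
      = {\<sigma>. \<sigma> permutes {1..n} \<and> (\<forall>J\<in>{B, B - I i d1, B - I j d2, B - I k d3}. \<sigma> ` J \<in> F)}"
      by (auto simp: S_def tri_def hit_def)
    then show "hits n F {{1..b}} \<le> real R ^ 4 * real (card D) ^ 3 *
      hits n F {{1..b}, {1..b} - I i d1, {1..b} - I j d2, {1..b} - I k d3}"
      using dense cardS by (simp add: hits_def B_def)
  qed (use I_disj ijk T I_card in simp_all)
qed

text \<open>Pairs whose lower layer is much denser in \<open>F\<close> than the upper one are few; they are discarded so that
  the layers of the lines can be compared with layer \<open>b\<close>.\<close>

lemma crown_of_dense_pairs:
  fixes c N :: real and B D :: "nat set" and F :: "nat set set" and n :: nat
  defines "H \<equiv> \<lambda>b. real (hits n F {{1..b}})"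
  assumes m: "2 \<le> m" and B: "finite B" and D: "D \<subseteq> {1..w}" "D \<noteq> {}"
    and range: "\<And>b. b \<in> B \<Longrightarrow> R * w \<le> b \<and> b + 3 * v \<le> n"
    and pairs: "2 * c * (\<Sum>b\<in>B. H b)
      \<le> (\<Sum>b\<in>B. \<Sum>d\<in>{d \<in> D. d \<le> b \<and> b - d \<in> B}. real (hits n F {{1..b}, {1..b - d}}))"
    and pos: "0 < (\<Sum>b\<in>B. H b)" and "0 < c" and R: "6 * real (2 * m + 3) \<le> R * c"
    and "0 < N" and N: "\<And>d. d \<in> D \<Longrightarrow> N \<le> (d + v) choose d"
    and big: "3 * (real (Suc m))\<^sup>2 < (c / (real R * real (card D)) ^ 4) ^ (Suc m ^ 3) * N"
  shows "weak_subposet (crown_carrier (2 * m + 3)) (crown_le (2 * m + 3)) F (\<subseteq>)"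
proof (rule ccontr)
  assume free: "\<not> ?thesis"
  let ?H = H and ?D = "real (card D)" and ?P = "\<lambda>b d. real (hits n F {{1..b}, {1..b - d}})"
  have finD: "finite D" using D finite_subset by blast
  have D0: "0 < ?D" using D finD by (simp add: card_gt_0_iff)
  have R0: "0 < R" using R \<open>0 < c\<close> by (cases R) auto
  have P_le: "?P b d \<le> ?H b" for b d
    using hits_antimono[of "{{1..b}}" "{{1..b}, {1..b - d}}"] by (simp add: H_def)
  define E where "E b = {d \<in> D. d \<le> b \<and> b - d \<in> B}" for b
  \<comment> \<open>Keeps the gaps whose lower layer is hit at most \<open>?D / c\<close> times as
    often as layer \<open>b\<close>.\<close>
  define E' where "E' b = {d \<in> E b. c / ?D * ?H (b - d) \<le> ?H b}" for b
  have finE: "finite (E b)" for b using finD by (simp add: E_def)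
  \<comment> \<open>For each \<open>d\<close> a layer is the lower one of at most one pair, so the
    discarded pairs amount to at most \<open>c * sum ?H B\<close>, half of the lower bound in
    \<open>pairs\<close>.\<close>
  have "(\<Sum>b\<in>B. \<Sum>d\<in>E b - E' b. ?P b d) \<le> (\<Sum>b\<in>B. \<Sum>d\<in>E b - E' b. c / ?D * ?H (b - d))"
  proof (intro sum_mono)
    fix b d assume "d \<in> E b - E' b"
    then show "?P b d \<le> c / ?D * ?H (b - d)" using P_le[of b d] by (auto simp: E'_def)
  qed
  also have "\<dots> \<le> (\<Sum>b\<in>B. \<Sum>d\<in>E b. c / ?D * ?H (b - d))"
    using finE \<open>0 < c\<close> by (intro sum_mono sum_mono2) (auto simp: H_def)
  also have "\<dots> = (\<Sum>d\<in>D. \<Sum>b\<in>{b \<in> B. d \<le> b \<and> b - d \<in> B}. c / ?D * ?H (b - d))"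
    unfolding E_def using B finD by (rule sum.swap_restrict)
  also have "\<dots> \<le> (\<Sum>d\<in>D. c / ?D * (\<Sum>b\<in>B. ?H b))"
  proof (rule sum_mono)
    fix d
    have "inj_on (\<lambda>b. b - d) {b \<in> B. d \<le> b \<and> b - d \<in> B}" by (auto simp: inj_on_def)
    then have "(\<Sum>b\<in>{b \<in> B. d \<le> b \<and> b - d \<in> B}. ?H (b - d)) = sum ?H ((\<lambda>b. b - d) ` {b \<in> B. d \<le> b \<and> b - d \<in> B})"
      by (simp add: sum.reindex)
    also have "\<dots> \<le> sum ?H B" using B by (intro sum_mono2) (auto simp: H_def)
    finally show "(\<Sum>b\<in>{b \<in> B. d \<le> b \<and> b - d \<in> B}. c / ?D * ?H (b - d)) \<le> c / ?D * sum ?H B"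
      unfolding sum_distrib_left[symmetric] using \<open>0 < c\<close> by (intro mult_left_mono) simp_all
  qed
  also have "\<dots> = c * sum ?H B" using D0 by simp
  finally have bad: "(\<Sum>b\<in>B. \<Sum>d\<in>E b - E' b. ?P b d) \<le> c * sum ?H B" .
  have "(\<Sum>b\<in>B. \<Sum>d\<in>E b. ?P b d) = (\<Sum>b\<in>B. (\<Sum>d\<in>E b - E' b. ?P b d) + (\<Sum>d\<in>E' b. ?P b d))"
    using finE by (intro sum.cong refl sum.subset_diff) (auto simp: E'_def)
  then have good: "c * sum ?H B \<le> (\<Sum>b\<in>B. \<Sum>d\<in>E' b. ?P b d)"
    using pairs bad by (simp add: sum.distrib E_def)
  \<comment> \<open>Averaging over layers. Layers with \<open>?H b = 0\<close> carry no pairs, so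
    the layer found can be taken with positive \<open>?H b\<close>.\<close>
  have "\<exists>b\<in>B. 0 < ?H b \<and> c * ?H b \<le> (\<Sum>d\<in>E' b. ?P b d)"
  proof (rule ccontr)
    assume neg: "\<not> (\<exists>b\<in>B. 0 < ?H b \<and> c * ?H b \<le> (\<Sum>d\<in>E' b. ?P b d))"
    have H0: "0 \<le> ?H b" for b by (simp add: H_def)
    have zero: "(\<Sum>d\<in>E' b. ?P b d) = 0" if "?H b = 0" for b
      using P_le[of b] that by (intro sum.neutral) (simp add: order_antisym)
    have le: "(\<Sum>d\<in>E' b. ?P b d) \<le> c * ?H b" if "b \<in> B" for b
      using neg zero[of b] H0[of b] that by (cases "?H b = 0") (auto simp: not_le less_le)
    obtain b where "b \<in> B" "0 < ?H b"
      using pos H0 by (metis less_le order_less_irrefl sum.neutral)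
    then have "(\<Sum>b\<in>B. \<Sum>d\<in>E' b. ?P b d) < (\<Sum>b\<in>B. c * ?H b)"
      using B le neg by (intro sum_strict_mono_ex1) (auto simp: not_le)
    then show False using good by (simp add: sum_distrib_left)
  qed
  then obtain b where b: "b \<in> B" "0 < ?H b" and many: "c * ?H b \<le> (\<Sum>d\<in>E' b. ?P b d)" by blast
  have E'D: "E' b \<subseteq> D" by (auto simp: E'_def E_def)
  have bn: "b \<le> n" "R * w \<le> b" "b + 3 * v \<le> n" using range[OF b(1)] by auto
  obtain I J K where I: "I \<union> J \<union> K \<subseteq> {1..b}" "I \<inter> J = {}" "I \<inter> K = {}" "J \<inter> K = {}"
    and gaps: "card I \<in> E' b" "card J \<in> E' b" "card K \<in> E' b"
    and dense: "hits n F {{1..b}} \<le> real R ^ 4 * real (card (E' b)) ^ 3 *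
      hits n F {{1..b}, {1..b} - I, {1..b} - J, {1..b} - K}"
  proof (rule dense_triple_of_pairs[OF free _ bn(1,2), of "E' b" c])
    show "E' b \<subseteq> {1..w}" using E'D D by blast
  qed (use many b R in \<open>auto simp: H_def\<close>)
  have ne: "L \<noteq> {}" if "card L \<in> E' b" for L :: "nat set"
    using that E'D D by auto
  let ?Q = "real (hits n F {{1..b}, {1..b} - I, {1..b} - J, {1..b} - K})"
  have "?H b \<le> real R ^ 4 * real (card (E' b)) ^ 3 * ?Q" using dense by (simp add: H_def)
  also have "\<dots> \<le> real R ^ 4 * ?D ^ 3 * ?Q"
    using card_mono[OF finD E'D] by (intro mult_right_mono mult_left_mono power_mono) auto
  finally have Hb: "?H b \<le> real R ^ 4 * ?D ^ 3 * ?Q" .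
  have "weak_subposet (crown_carrier (2 * m + 3)) (crown_le (2 * m + 3)) F (\<subseteq>)"
  proof (rule crown_of_dense_triple[OF m I _ _ _ bn(3)])
    show "I \<noteq> {}" "J \<noteq> {}" "K \<noteq> {}" using ne gaps by blast+
    show "hits n F {{1..b - card L}} \<le> ?D / c * ?H b" if "L \<in> {I, J, K}" for L
    proof -
      have "card L \<in> E' b" using that gaps by auto
      then have "c / ?D * ?H (b - card L) \<le> ?H b" by (simp add: E'_def)
      then show ?thesis using D0 \<open>0 < c\<close> by (simp add: H_def field_simps)
    qed
    \<comment> \<open>The bound on lines costs a factor \<open>?D / c\<close> and the pigeonhole a
      factor \<open>real R ^ 4 * ?D ^ 3\<close>; together they make up this density.\<close>
    show "c / (real R * ?D) ^ 4 * (?D / c * ?H b) \<le> ?Q"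
      using Hb D0 \<open>0 < c\<close> R0 by (simp add: field_simps power_mult_distrib power4_eq_xxxx power3_eq_cube)
    show "N \<le> (card L + v) choose card L" if "L \<in> {I, J, K}" for L
      using that gaps E'D by (intro N) auto
    show "0 < ?D / c * ?H b" using D0 \<open>0 < c\<close> b by simp
  qed (use big \<open>0 < N\<close> \<open>0 < c\<close> in auto)
  with free show False by blast
qed

section \<open>Random chains through a large family\<close>

text \<open>Every element other than the minimum forms a pair with the minimum.\<close>

lemma card_le_Suc_card_pairs:
  fixes X :: "nat set"
  assumes "finite X"
  shows "card X \<le> 1 + card {(b, d). b \<in> X \<and> 1 \<le> d \<and> d \<le> b \<and> b - d \<in> X}"
proof (cases "X = {}")
  case False
  let ?P = "{(b, d). b \<in> X \<and> 1 \<le> d \<and> d \<le> b \<and> b - d \<in> X}"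
  have "?P \<subseteq> X \<times> {..Max X}"
    using assms Max_ge[OF assms] le_trans by fastforce
  then have fin: "finite ?P" using assms finite_subset by blast
  have "(\<lambda>b. (b, b - Min X)) ` (X - {Min X}) \<subseteq> ?P"
  proof (rule image_subsetI)
    fix b assume b: "b \<in> X - {Min X}"
    then have "Min X \<le> b" "Min X \<noteq> b" using assms by auto
    then show "(b, b - Min X) \<in> ?P" using b Min_in[OF assms False] by simp
  qed
  then have "card ((\<lambda>b. (b, b - Min X)) ` (X - {Min X})) \<le> card ?P"
    using fin by (rule card_mono[rotated])
  moreover have "card ((\<lambda>b. (b, b - Min X)) ` (X - {Min X})) = card X - 1"
    using assms False by (subst card_image) (auto simp: inj_on_def)
  ultimately show ?thesis by simp
qed simp

text \<open>The preceding count is applied to the layers in which the random chain meets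
  \<open>F\<close> and summed over all permutations; \<open>fact n\<close> collects the summands
  1.\<close>

lemma sum_hits_le_pairs:
  fixes B :: "nat set"
  assumes B: "finite B" and w: "\<And>a b. a \<in> B \<Longrightarrow> b \<in> B \<Longrightarrow> b \<le> a + w"
  shows "(\<Sum>b\<in>B. hits n F {{1..b}})
    \<le> fact n + (\<Sum>b\<in>B. \<Sum>d\<in>{d \<in> {1..w}. d \<le> b \<and> b - d \<in> B}. hits n F {{1..b}, {1..b - d}})"
proof -
  define S where "S = {\<sigma>. \<sigma> permutes {1..n}}"
  define on where "on \<sigma> b \<longleftrightarrow> \<sigma> ` {1..b} \<in> F" for \<sigma> :: "nat \<Rightarrow> nat" and b
  define P where "P = (SIGMA b:B. {d \<in> {1..w}. d \<le> b \<and> b - d \<in> B})"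
  have finS: "finite S" by (simp add: S_def finite_permutations)
  have finP: "finite P" using B by (simp add: P_def)
  have single: "hits n F {{1..b}} = card {\<sigma> \<in> S. on \<sigma> b}" for b
    by (simp add: hits_def S_def on_def)
  have pair: "hits n F {{1..b}, {1..b - d}} = card {\<sigma> \<in> S. on \<sigma> b \<and> on \<sigma> (b - d)}" for b d
    by (simp add: hits_def S_def on_def)
  have "(\<Sum>b\<in>B. hits n F {{1..b}}) = (\<Sum>\<sigma>\<in>S. card {b \<in> B. on \<sigma> b})"
    unfolding single by (rule sum_multicount_gen[symmetric]) (simp_all add: finS B)
  also have "\<dots> \<le> (\<Sum>\<sigma>\<in>S. 1 + card {p \<in> P. on \<sigma> (fst p) \<and> on \<sigma> (fst p - snd p)})"
  proof (rule sum_mono)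
    fix \<sigma>
    let ?X = "{b \<in> B. on \<sigma> b}"
    have "card ?X \<le> 1 + card {(b, d). b \<in> ?X \<and> 1 \<le> d \<and> d \<le> b \<and> b - d \<in> ?X}"
      using B by (intro card_le_Suc_card_pairs) simp
    also have "{(b, d). b \<in> ?X \<and> 1 \<le> d \<and> d \<le> b \<and> b - d \<in> ?X}
        \<subseteq> {p \<in> P. on \<sigma> (fst p) \<and> on \<sigma> (fst p - snd p)}"
    proof
      fix p assume "p \<in> {(b, d). b \<in> ?X \<and> 1 \<le> d \<and> d \<le> b \<and> b - d \<in> ?X}"
      then obtain b d where p: "p = (b, d)" "b \<in> ?X" "1 \<le> d" "d \<le> b" "b - d \<in> ?X" by blast
      then have "b \<le> (b - d) + w" using w[of "b - d" b] by simp
      then have "d \<le> w" using p by simp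
      then show "p \<in> {p \<in> P. on \<sigma> (fst p) \<and> on \<sigma> (fst p - snd p)}" using p by (simp add: P_def)
    qed
    then have "card {(b, d). b \<in> ?X \<and> 1 \<le> d \<and> d \<le> b \<and> b - d \<in> ?X}
        \<le> card {p \<in> P. on \<sigma> (fst p) \<and> on \<sigma> (fst p - snd p)}"
      using finP by (intro card_mono) simp_all
    finally show "card ?X \<le> 1 + card {p \<in> P. on \<sigma> (fst p) \<and> on \<sigma> (fst p - snd p)}" by simp
  qed
  also have "\<dots> = card S + (\<Sum>\<sigma>\<in>S. card {p \<in> P. on \<sigma> (fst p) \<and> on \<sigma> (fst p - snd p)})"
    by (simp add: sum_Suc)
  also have "card S = fact n" by (simp add: S_def card_permutations)
  also have "(\<Sum>\<sigma>\<in>S. card {p \<in> P. on \<sigma> (fst p) \<and> on \<sigma> (fst p - snd p)})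
      = (\<Sum>p\<in>P. hits n F {{1..fst p}, {1..fst p - snd p}})"
    unfolding pair by (rule sum_multicount_gen) (simp_all add: finS finP)
  also have "\<dots> = (\<Sum>b\<in>B. \<Sum>d\<in>{d \<in> {1..w}. d \<le> b \<and> b - d \<in> B}. hits n F {{1..b}, {1..b - d}})"
    unfolding P_def using B by (subst sum.Sigma) (auto simp: case_prod_beta)
  finally show ?thesis .
qed

text \<open>A LYM-type estimate: \<open>hits_level\<close> is exact on each layer, and every
  binomial coefficient is at most the central one.\<close>

lemma fact_card_le_sum_hits:
  assumes F: "F \<subseteq> Pow {1..n}" and B: "B \<subseteq> {..n}"
  shows "fact n * card {A \<in> F. card A \<in> B} \<le> (n choose (n div 2)) * (\<Sum>b\<in>B. hits n F {{1..b}})"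
proof -
  have finF: "finite F" using F finite_subset by blast
  have finB: "finite B" using B finite_subset by blast
  have "{A \<in> F. card A \<in> B} = (\<Union>b\<in>B. {A \<in> F. card A = b})" by auto
  then have "card {A \<in> F. card A \<in> B} = (\<Sum>b\<in>B. card {A \<in> F. card A = b})"
    using finF finB by (simp only:) (rule card_UN_disjoint, auto)
  then have "fact n * card {A \<in> F. card A \<in> B} = (\<Sum>b\<in>B. fact n * card {A \<in> F. card A = b})"
    by (simp add: sum_distrib_left)
  also have "\<dots> = (\<Sum>b\<in>B. (n choose b) * hits n F {{1..b}})"
    using hits_level[OF F] B by (intro sum.cong) auto
  also have "\<dots> \<le> (\<Sum>b\<in>B. (n choose (n div 2)) * hits n F {{1..b}})"
    by (intro sum_mono mult_right_mono binomial_maximum) simp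
  finally show ?thesis by (simp add: sum_distrib_left)
qed

text \<open>Hoeffding's inequality for the binomial distribution with parameter 1/2, converted to
  the central coefficient, which is at least \<open>2 ^ n / (n + 1)\<close>.\<close>

lemma card_subsets_off_centre_le:
  assumes F: "F \<subseteq> Pow {1..n}" and "0 < n"
  shows "card {A \<in> F. card A \<notin> {n div 2 - h..n div 2 + h}}
    \<le> 2 * real (n + 1) * exp (- 2 * (real h)\<^sup>2 / n) * (n choose (n div 2))"
proof -
  interpret binomial_distribution n "1 / 2" by unfold_locales simp
  define K where "K = {k. k \<le> n \<and> k \<notin> {n div 2 - h..n div 2 + h}}"
  have finK: "finite K" by (simp add: K_def)
  have "{A \<in> F. card A \<notin> {n div 2 - h..n div 2 + h}} \<subseteq> (\<Union>k\<in>K. {A. A \<subseteq> {1..n} \<and> card A = k})"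
  proof
    fix A assume A: "A \<in> {A \<in> F. card A \<notin> {n div 2 - h..n div 2 + h}}"
    then have "A \<subseteq> {1..n}" using F by blast
    moreover from this have "card A \<le> n" using card_mono[of "{1..n}" A] by simp
    ultimately show "A \<in> (\<Union>k\<in>K. {A. A \<subseteq> {1..n} \<and> card A = k})" using A by (simp add: K_def)
  qed
  then have "card {A \<in> F. card A \<notin> {n div 2 - h..n div 2 + h}} \<le> card (\<Union>k\<in>K. {A. A \<subseteq> {1..n} \<and> card A = k})"
    using finK by (intro card_mono) auto
  also have "\<dots> \<le> (\<Sum>k\<in>K. card {A. A \<subseteq> {1..n} \<and> card A = k})" by (rule card_UN_le[OF finK])
  also have "\<dots> = (\<Sum>k\<in>K. n choose k)" using n_subsets[of "{1..n}"] by simp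
  finally have 1: "card {A \<in> F. card A \<notin> {n div 2 - h..n div 2 + h}} \<le> (\<Sum>k\<in>K. n choose k)" .
  have "(\<Sum>k\<in>K. real (n choose k)) / 2 ^ n = (\<Sum>k\<in>K. pmf (binomial_pmf n (1 / 2)) k)"
    unfolding sum_divide_distrib
    by (intro sum.cong refl) (auto simp: K_def power_add[symmetric] power_one_over field_simps)
  also have "\<dots> = measure_pmf.prob (binomial_pmf n (1 / 2)) K"
    by (rule measure_measure_pmf_finite[OF finK, symmetric])
  \<comment> \<open>Rounding in \<open>n div 2\<close> does no harm: outside the window the distance
    from \<open>n / 2\<close> is still at least \<open>h\<close>.\<close>
  also have "\<dots> \<le> measure_pmf.prob (binomial_pmf n (1 / 2)) {x. \<bar>real x - real n * (1 / 2)\<bar> \<ge> real h}"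
    by (intro measure_pmf.finite_measure_mono) (auto simp: K_def)
  also have "\<dots> \<le> 2 * exp (- 2 * (real h)\<^sup>2 / n)" using prob_abs_ge[OF \<open>0 < n\<close>, of "real h"] by simp
  finally have 2: "(\<Sum>k\<in>K. real (n choose k)) \<le> 2 * exp (- 2 * (real h)\<^sup>2 / n) * 2 ^ n"
    by (simp add: field_simps)
  have "(2::nat) ^ n = (\<Sum>k\<le>n. n choose k)" by (simp add: choose_row_sum)
  also have "\<dots> \<le> (\<Sum>k\<le>n. n choose (n div 2))" by (intro sum_mono binomial_maximum)
  also have "\<dots> = (n + 1) * (n choose (n div 2))" by simp
  finally have "real (2 ^ n) \<le> real ((n + 1) * (n choose (n div 2)))" by (rule of_nat_mono)
  then have "(2::real) ^ n \<le> real (n + 1) * (n choose (n div 2))"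
    by (simp only: of_nat_mult of_nat_power of_nat_numeral)
  then have 3: "2 * exp (- 2 * (real h)\<^sup>2 / n) * 2 ^ n
      \<le> 2 * exp (- 2 * (real h)\<^sup>2 / n) * (real (n + 1) * (n choose (n div 2)))"
    by (intro mult_left_mono) simp_all
  have "real (card {A \<in> F. card A \<notin> {n div 2 - h..n div 2 + h}}) \<le> (\<Sum>k\<in>K. real (n choose k))"
    using of_nat_mono[OF 1, where 'a = real] by (simp only: of_nat_sum)
  also note 2
  also note 3
  also have "2 * exp (- 2 * (real h)\<^sup>2 / n) * (real (n + 1) * (n choose (n div 2)))
      = 2 * real (n + 1) * exp (- 2 * (real h)\<^sup>2 / n) * (n choose (n div 2))"
    by (simp only: mult_ac)
  finally show ?thesis .
qed

section \<open>Crowns in large families and the choice of parameters\<close>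

text \<open>Pairs on the random chain are split by their gap at \<open>D0\<close>, and one of the
  two kinds accounts for half of the bound. Short gaps take fewer than \<open>D0\<close> values and
  allow at least \<open>v + 1\<close> blocks; long gaps may take up to \<open>n\<close> values but
  allow at least \<open>(D0 + v) choose D0\<close> blocks.\<close>

lemma crown_if_large:
  fixes \<epsilon> c :: real
  assumes "0 < \<epsilon>" and m: "2 \<le> m" and "0 < n" and F: "F \<subseteq> Pow {1..n}"
    and large: "(1 + \<epsilon>) * (n choose (n div 2)) \<le> card F"
    and c: "c = \<epsilon> / (4 * (2 + \<epsilon>))" and R: "6 * real (2 * m + 3) \<le> R * c"
    and h: "16 * R * h \<le> n" and v: "12 * v \<le> n" and D0: "2 \<le> D0" "D0 \<le> 2 * h"
    and tail: "2 * real (n + 1) * exp (- 2 * (real h)\<^sup>2 / n) \<le> \<epsilon> / 2"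
    and short: "3 * (real (Suc m))\<^sup>2 < (c / (real R * real D0) ^ 4) ^ (Suc m ^ 3) * (real v + 1)"
    and long: "3 * (real (Suc m))\<^sup>2 < (c / (real R * real n) ^ 4) ^ (Suc m ^ 3) * ((D0 + v) choose D0)"
  shows "weak_subposet (crown_carrier (2 * m + 3)) (crown_le (2 * m + 3)) F (\<subseteq>)"
proof -
  define w where "w = 2 * h"
  define B where "B = {n div 2 - h..n div 2 + h}"
  define H where "H b = real (hits n F {{1..b}})" for b
  define P where "P D = (\<Sum>b\<in>B. \<Sum>d\<in>{d \<in> D. d \<le> b \<and> b - d \<in> B}. real (hits n F {{1..b}, {1..b - d}}))" for D
  define C where "C = real (n choose (n div 2))"
  have C0: "0 < C" by (simp add: C_def)
  have c0: "0 < c" using \<open>0 < \<epsilon>\<close> by (simp add: c)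
  have R0: "1 \<le> R" using R c0 by (cases R) auto
  have Rh: "R * h \<le> n div 16" using h by simp
  have hR: "h \<le> R * h" using R0 by simp
  have h_n: "16 * h \<le> n" using Rh hR by linarith
  \<comment> \<open>Layers near \<open>n div 2\<close> leave room on both sides:
    \<open>R * w\<close> is at most \<open>n / 8\<close>, \<open>h\<close> at most
    \<open>n / 16\<close> and \<open>3 * v\<close> at most \<open>n / 4\<close>.\<close>
  have range: "R * w \<le> b \<and> b + 3 * v \<le> n" if "b \<in> B" for b
  proof -
    have "R * w = 2 * (R * h)" by (simp add: w_def)
    moreover have "n div 2 \<le> b + h" "b \<le> n div 2 + h" using that by (auto simp: B_def)
    ultimately show ?thesis using h Rh h_n v \<open>0 < n\<close> by (intro conjI) linarith+
  qed
  have finF: "finite F" using F finite_subset by blast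
  have "F = {A \<in> F. card A \<in> B} \<union> {A \<in> F. card A \<notin> B}" by auto
  then have "card F \<le> card {A \<in> F. card A \<in> B} + card {A \<in> F. card A \<notin> B}"
    using card_Un_le[of "{A \<in> F. card A \<in> B}" "{A \<in> F. card A \<notin> B}"] by simp
  moreover have "card {A \<in> F. card A \<notin> B} \<le> \<epsilon> / 2 * C"
  proof -
    have "card {A \<in> F. card A \<notin> B} \<le> 2 * real (n + 1) * exp (- 2 * (real h)\<^sup>2 / n) * C"
      unfolding B_def C_def by (rule card_subsets_off_centre_le[OF F \<open>0 < n\<close>])
    also have "\<dots> \<le> \<epsilon> / 2 * C" using tail C0 by (intro mult_right_mono) simp_all
    finally show ?thesis .
  qed
  ultimately have centre: "(1 + \<epsilon> / 2) * C \<le> card {A \<in> F. card A \<in> B}"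
    using large by (simp add: C_def algebra_simps)
  have "B \<subseteq> {..n}" using h_n by (auto simp: B_def)
  note level_sum = of_nat_mono[OF fact_card_le_sum_hits[OF F this], where 'a = real]
  have "C * (fact n * (1 + \<epsilon> / 2)) = fact n * ((1 + \<epsilon> / 2) * C)" by (simp only: mult_ac)
  also have "\<dots> \<le> fact n * real (card {A \<in> F. card A \<in> B})"
    using centre by (intro mult_left_mono) simp_all
  also have "\<dots> \<le> C * sum H B"
    using level_sum by (simp add: C_def H_def)
  finally have "C * (fact n * (1 + \<epsilon> / 2)) \<le> C * sum H B" .
  then have HB: "fact n * (1 + \<epsilon> / 2) \<le> sum H B" using C0 by simp
  have "0 < fact n * (1 + \<epsilon> / 2)" using \<open>0 < \<epsilon>\<close> by simp
  then have HB0: "0 < sum H B" using HB by linarith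
  have "sum H B \<le> fact n + P {1..w}"
  proof -
    have "(\<Sum>b\<in>B. hits n F {{1..b}})
      \<le> fact n + (\<Sum>b\<in>B. \<Sum>d\<in>{d \<in> {1..w}. d \<le> b \<and> b - d \<in> B}. hits n F {{1..b}, {1..b - d}})"
      by (rule sum_hits_le_pairs) (auto simp: B_def w_def)
    then have "real (\<Sum>b\<in>B. hits n F {{1..b}})
      \<le> real (fact n + (\<Sum>b\<in>B. \<Sum>d\<in>{d \<in> {1..w}. d \<le> b \<and> b - d \<in> B}. hits n F {{1..b}, {1..b - d}}))"
      by (rule of_nat_mono)
    then show ?thesis by (simp add: H_def P_def)
  qed
  moreover have "fact n \<le> sum H B / (1 + \<epsilon> / 2)" using HB \<open>0 < \<epsilon>\<close> by (simp add: field_simps)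
  \<comment> \<open>The origin of \<open>c\<close>: the pairs amount to at least the share
    \<open>\<epsilon> / (2 + \<epsilon>) = 4 * c\<close>, which leaves \<open>2 * c\<close> for one
    half of the split.\<close>
  moreover have "sum H B - sum H B / (1 + \<epsilon> / 2) = 4 * c * sum H B"
    using \<open>0 < \<epsilon>\<close> by (simp add: c field_simps)
  ultimately have "4 * c * sum H B \<le> P {1..w}" by linarith
  moreover have "P {1..w} = P {1..<D0} + P {D0..w}"
  proof -
    have "(\<Sum>d\<in>{d \<in> {1..w}. Q d}. g d) = (\<Sum>d\<in>{d \<in> {1..<D0}. Q d}. g d) + (\<Sum>d\<in>{d \<in> {D0..w}. Q d}. g d)"
      for Q and g :: "nat \<Rightarrow> real"
    proof -
      have split: "{d \<in> {1..w}. Q d} = {d \<in> {1..<D0}. Q d} \<union> {d \<in> {D0..w}. Q d}"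
        using D0 by (auto simp: w_def)
      show ?thesis unfolding split by (rule sum.union_disjoint) auto
    qed
    then show ?thesis by (simp only: P_def sum.distrib)
  qed
  ultimately consider "2 * c * sum H B \<le> P {1..<D0}" | "2 * c * sum H B \<le> P {D0..w}" by linarith
  then show ?thesis
  proof cases
    case 1
    show ?thesis
    proof (rule crown_of_dense_pairs[OF m, of B "{1..<D0}" w R v n c F "real v + 1"])
      show "2 * c * (\<Sum>b\<in>B. real (hits n F {{1..b}}))
        \<le> (\<Sum>b\<in>B. \<Sum>d\<in>{d \<in> {1..<D0}. d \<le> b \<and> b - d \<in> B}. real (hits n F {{1..b}, {1..b - d}}))"
        using 1 by (simp add: H_def P_def)
      show "0 < (\<Sum>b\<in>B. real (hits n F {{1..b}}))" using HB0 by (simp add: H_def)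
      show "real v + 1 \<le> (d + v) choose d" if "d \<in> {1..<D0}" for d
      proof -
        have "Suc v \<le> (d + v) choose v"
          using that binomial_right_mono[of "Suc v" "d + v" v] by simp
        then show ?thesis by (simp add: binomial_symmetric[of d "d + v"])
      qed
      have "c / (real R * real D0) ^ 4 \<le> c / (real R * real (card {1..<D0})) ^ 4"
        using c0 R0 D0 by (intro divide_left_mono power_mono mult_left_mono mult_pos_pos) auto
      then have "(c / (real R * real D0) ^ 4) ^ (Suc m ^ 3) * (real v + 1)
        \<le> (c / (real R * real (card {1..<D0})) ^ 4) ^ (Suc m ^ 3) * (real v + 1)"
        using c0 by (intro mult_right_mono power_mono) auto
      then show "3 * (real (Suc m))\<^sup>2 < (c / (real R * real (card {1..<D0})) ^ 4) ^ (Suc m ^ 3) * (real v + 1)"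
        using short by linarith
    qed (use range D0 c0 R in \<open>auto simp: w_def B_def\<close>)
  next
    case 2
    let ?N = "real ((D0 + v) choose D0)"
    show ?thesis
    proof (rule crown_of_dense_pairs[OF m, of B "{D0..w}" w R v n c F ?N])
      show "2 * c * (\<Sum>b\<in>B. real (hits n F {{1..b}}))
        \<le> (\<Sum>b\<in>B. \<Sum>d\<in>{d \<in> {D0..w}. d \<le> b \<and> b - d \<in> B}. real (hits n F {{1..b}, {1..b - d}}))"
        using 2 by (simp add: H_def P_def)
      show "0 < (\<Sum>b\<in>B. real (hits n F {{1..b}}))" using HB0 by (simp add: H_def)
      show "?N \<le> (d + v) choose d" if "d \<in> {D0..w}" for d
        using that binomial_right_mono[of "D0 + v" "d + v" v]
        by (simp add: binomial_symmetric[of d "d + v"] binomial_symmetric[of D0 "D0 + v"])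
      have card: "card {D0..w} \<le> n" "0 < card {D0..w}" using D0 h_n by (auto simp: w_def)
      then have "c / (real R * real n) ^ 4 \<le> c / (real R * real (card {D0..w})) ^ 4"
        using c0 R0 \<open>0 < n\<close> by (intro divide_left_mono power_mono mult_left_mono mult_pos_pos zero_less_power) auto
      then have "(c / (real R * real n) ^ 4) ^ (Suc m ^ 3) * ?N
        \<le> (c / (real R * real (card {D0..w})) ^ 4) ^ (Suc m ^ 3) * ?N"
        using c0 by (intro mult_right_mono power_mono) auto
      then show "3 * (real (Suc m))\<^sup>2 < (c / (real R * real (card {D0..w})) ^ 4) ^ (Suc m ^ 3) * ?N"
        using long by linarith
    qed (use range D0 c0 R in \<open>auto simp: w_def B_def\<close>)
  qed
qed

text \<open>The side conditions of \<open>crown_if_large\<close> all hold for large \<open>n\<close>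
  when \<open>R\<close> and \<open>D0\<close> are constants and \<open>h\<close>, \<open>v\<close>
  grow linearly in \<open>n\<close>.\<close>

lemma eventually_crown:
  fixes \<epsilon> :: real
  assumes "0 < \<epsilon>" and m: "2 \<le> m"
  shows "eventually (\<lambda>n. \<forall>F \<subseteq> Pow {1..n}. (1 + \<epsilon>) * (n choose (n div 2)) \<le> card F \<longrightarrow>
    weak_subposet (crown_carrier (2 * m + 3)) (crown_le (2 * m + 3)) F (\<subseteq>)) sequentially"
proof -
  define c where "c = \<epsilon> / (4 * (2 + \<epsilon>))"
  have c0: "0 < c" using \<open>0 < \<epsilon>\<close> by (simp add: c_def)
  define R where "R = nat \<lceil>6 * real (2 * m + 3) / c\<rceil>"
  have "6 * real (2 * m + 3) / c \<le> R" unfolding R_def by linarith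
  then have R: "6 * real (2 * m + 3) \<le> R * c" using c0 by (simp add: field_simps)
  then have R0: "1 \<le> R" using c0 by (cases R) auto
  define S where "S = Suc m ^ 3"
  \<comment> \<open>For long gaps the density loses a factor of order \<open>n ^ (4 * S)\<close>,
    while the number of blocks grows like \<open>n ^ D0\<close>; the surplus is the square of
    \<open>n\<close> in \<open>lim3\<close>.\<close>
  define D0 where "D0 = 4 * S + 2"
  define h v where "h n = n div (16 * R)" and "v n = n div 12" for n :: nat
  define q where "q = 3 * (real (Suc m))\<^sup>2"
  define k1 where "k1 = (c / (real R * real D0) ^ 4) ^ S"
  define k2 where "k2 = (c / real R ^ 4) ^ S / (12 * real D0) ^ D0"
  have k0: "0 < k1" "0 < k2" "0 < D0" using c0 R0 by (simp_all add: k1_def k2_def D0_def)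
  \<comment> \<open>The Hoeffding exponent that results from \<open>h n \<ge> n / (32 * R)\<close>,
    shown in \<open>h_ge\<close>.\<close>
  define \<kappa> where "\<kappa> = 2 / (32 * real R)\<^sup>2"
  have "0 < \<kappa>" using R0 by (simp add: \<kappa>_def)
  then have "((\<lambda>n. 2 * real (n + 1) * exp (- \<kappa> * real n)) \<longlongrightarrow> 0) sequentially"
    by real_asymp
  then have lim1: "eventually (\<lambda>n. 2 * real (n + 1) * exp (- \<kappa> * real n) < \<epsilon> / 2) sequentially"
    using \<open>0 < \<epsilon>\<close> by (intro order_tendstoD) auto
  have lim2: "eventually (\<lambda>n. q < k1 * (real n / 12)) sequentially"
    using k0 by real_asymp
  have lim3: "eventually (\<lambda>n. q < k2 * (real n)\<^sup>2) sequentially"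
    using k0 by real_asymp
  have lim4: "eventually (\<lambda>n. 16 * R * (D0 + 2) \<le> n) sequentially"
    by (rule eventually_ge_at_top)
  show ?thesis
    using lim1 lim2 lim3 lim4
  proof eventually_elim
    case (elim n)
    have "16 * R \<le> 16 * R * (D0 + 2)" by simp
    then have n0: "0 < n" "16 * R \<le> n" using elim(4) R0 by linarith+
    have hD0: "D0 + 2 \<le> h n"
      unfolding h_def using elim(4) R0 by (simp add: less_eq_div_iff_mult_less_eq mult.commute)
    have h_ge: "real n / (32 * real R) \<le> h n"
    proof -
      have "n = 16 * R * h n + n mod (16 * R)" by (simp add: h_def)
      moreover have "n mod (16 * R) < 16 * R" using R0 by simp
      moreover have "16 * R * 1 \<le> 16 * R * h n" using hD0 by (intro mult_le_mono2) simp
      ultimately have "n \<le> 32 * R * h n" by linarith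
      then have "real n \<le> real (32 * R * h n)" by (rule of_nat_mono)
      then show ?thesis using R0 by (simp add: field_simps)
    qed
    have v_ge: "real n / 12 \<le> real (v n) + 1" unfolding v_def by linarith
    have "\<forall>F. F \<subseteq> Pow {1..n} \<and> (1 + \<epsilon>) * (n choose (n div 2)) \<le> card F \<longrightarrow>
      weak_subposet (crown_carrier (2 * m + 3)) (crown_le (2 * m + 3)) F (\<subseteq>)"
    proof (intro allI impI, elim conjE)
      fix F assume F: "F \<subseteq> Pow {1..n}" "(1 + \<epsilon>) * (n choose (n div 2)) \<le> card F"
      show "weak_subposet (crown_carrier (2 * m + 3)) (crown_le (2 * m + 3)) F (\<subseteq>)"
      proof (rule crown_if_large[OF \<open>0 < \<epsilon>\<close> m n0(1) F c_def R, of "h n" "v n" D0])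
        show "16 * R * h n \<le> n" "12 * v n \<le> n" by (simp_all add: h_def v_def)
        show "2 \<le> D0" by (simp add: D0_def)
        show "D0 \<le> 2 * h n" using hD0 by simp
        have "\<kappa> * real n = 2 * (real n / (32 * real R))\<^sup>2 / real n"
          using n0 by (simp add: \<kappa>_def power2_eq_square)
        also have "\<dots> \<le> 2 * (real (h n))\<^sup>2 / real n"
          using h_ge by (intro divide_right_mono mult_left_mono power_mono) auto
        finally have "exp (- 2 * (real (h n))\<^sup>2 / n) \<le> exp (- \<kappa> * real n)" by simp
        then have "2 * real (n + 1) * exp (- 2 * (real (h n))\<^sup>2 / n) \<le> 2 * real (n + 1) * exp (- \<kappa> * real n)"
          by (intro mult_left_mono) simp_all
        then show "2 * real (n + 1) * exp (- 2 * (real (h n))\<^sup>2 / n) \<le> \<epsilon> / 2"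
          using elim(1) by linarith
        have "k1 * (real n / 12) \<le> k1 * (real (v n) + 1)"
          using v_ge k0 by (intro mult_left_mono) auto
        then show "3 * (real (Suc m))\<^sup>2 < (c / (real R * real D0) ^ 4) ^ (Suc m ^ 3) * (real (v n) + 1)"
          using elim(2) by (simp add: k1_def q_def S_def)
        have "real n / 12 \<le> real (D0 + v n)" using v_ge k0 by simp
        then have "real n / (12 * real D0) \<le> real (D0 + v n) / real D0"
          using k0 by (simp add: field_simps)
        then have "(real n / (12 * real D0)) ^ D0 \<le> (real (D0 + v n) / real D0) ^ D0"
          by (intro power_mono) auto
        also have "\<dots> \<le> (D0 + v n) choose D0"
          by (rule binomial_ge_n_over_k_pow_k) simp
        finally have "(c / (real R * real n) ^ 4) ^ S * (real n / (12 * real D0)) ^ D0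
          \<le> (c / (real R * real n) ^ 4) ^ S * ((D0 + v n) choose D0)"
          using c0 by (intro mult_left_mono) auto
        moreover have "(c / (real R * real n) ^ 4) ^ S * (real n / (12 * real D0)) ^ D0 = k2 * (real n)\<^sup>2"
        proof -
          define p where "p = (real n ^ 4) ^ S"
          have "p \<noteq> 0" using n0 by (simp add: p_def)
          have 1: "(c / (real R * real n) ^ 4) ^ S = (c / real R ^ 4) ^ S / p"
            by (simp add: p_def power_mult_distrib power_divide)
          have 2: "real n ^ D0 = p * (real n)\<^sup>2"
            unfolding p_def D0_def by (simp only: power_add power_mult)
          show ?thesis
            unfolding 1 power_divide[of "real n"] 2 k2_def using \<open>p \<noteq> 0\<close> by simp
        qed
        ultimately show "3 * (real (Suc m))\<^sup>2 < (c / (real R * real n) ^ 4) ^ (Suc m ^ 3) * ((D0 + v n) choose D0)"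
          using elim(3) by (simp add: q_def S_def)
      qed
    qed
    then show ?case by blast
  qed
qed

section \<open>The middle layer and the asymptotic statement\<close>

text \<open>Finite sets of equal size are comparable only if equal, while the crown demands two
  distinct comparable sets, the images of \<open>(False, 0)\<close> and
  \<open>(True, 0)\<close>.\<close>

lemma middle_layer_crown_free:
  assumes "0 < t"
  shows "P_free {A. A \<subseteq> {1..n} \<and> card A = k} (crown_carrier t) (crown_le t)"
  unfolding P_free_def weak_subposet_def
proof clarify
  fix f assume inj: "inj_on f (crown_carrier t)" and img: "f ` crown_carrier t \<subseteq> {A. A \<subseteq> {1..n} \<and> card A = k}"
    and le: "\<forall>u\<in>crown_carrier t. \<forall>v\<in>crown_carrier t. crown_le t u v \<longrightarrow> f u \<subseteq> f v"
  have mem: "(False, 0) \<in> crown_carrier t" "(True, 0) \<in> crown_carrier t" using assms by (simp_all add: crown_carrier_def)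
  have "f (False, 0) \<subseteq> f (True, 0)" using le mem by (simp add: crown_le_def)
  moreover have "card (f (False, 0)) = k" "card (f (True, 0)) = k" "finite (f (True, 0))"
    using img mem finite_subset[of "f (True, 0)" "{1..n}"] by auto
  ultimately have "f (False, 0) = f (True, 0)" by (metis card_subset_eq)
  then show False using inj mem by (auto simp: inj_on_def)
qed

text \<open>The maximum in \<open>La\<close> runs over a finite set that contains the size of the
  middle layer, so it is attained.\<close>

lemma La_crown_bounds:
  assumes "0 < t"
  shows "n choose (n div 2) \<le> La n (crown_carrier t) (crown_le t)"
    and "\<exists>F \<subseteq> Pow {1..n}. P_free F (crown_carrier t) (crown_le t) \<and> card F = La n (crown_carrier t) (crown_le t)"
proof -
  let ?L = "{card F | F. F \<subseteq> Pow {1..n} \<and> P_free F (crown_carrier t) (crown_le t)}"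
  let ?M = "{A. A \<subseteq> {1..n} \<and> card A = n div 2}"
  have "?L \<subseteq> card ` Pow (Pow {1..n})" by auto
  then have fin: "finite ?L" using finite_subset by blast
  have "card ?M \<in> ?L" using middle_layer_crown_free[OF assms] by blast
  moreover have "card ?M = n choose (n div 2)" using n_subsets[of "{1..n}" "n div 2"] by simp
  ultimately have mid: "n choose (n div 2) \<in> ?L" by simp
  show "n choose (n div 2) \<le> La n (crown_carrier t) (crown_le t)"
    unfolding La_def using fin mid by (rule Max_ge)
  have "La n (crown_carrier t) (crown_le t) \<in> ?L"
    unfolding La_def using fin mid by (intro Max_in) auto
  then obtain F where "F \<subseteq> Pow {1..n}" "P_free F (crown_carrier t) (crown_le t)"
    "La n (crown_carrier t) (crown_le t) = card F" by blast
  then show "\<exists>F \<subseteq> Pow {1..n}. P_free F (crown_carrier t) (crown_le t) \<and> card F = La n (crown_carrier t) (crown_le t)"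
    by (intro exI[of _ F]) simp
qed

theorem theorem1:
  fixes t :: nat
  assumes "odd t" and "t \<ge> 7"
  shows "(\<lambda>n. real (La n (crown_carrier t) (crown_le t))) \<sim>[at_top] (\<lambda>n. real (n choose (n div 2)))"
proof (rule asymp_equivI', rule tendstoI)
  fix \<epsilon> :: real assume "0 < \<epsilon>"
  \<comment> \<open>Odd \<open>t \<ge> 7\<close> are exactly the lengths \<open>2 * m + 3\<close>
    with \<open>2 \<le> m\<close> of the closed walks in the grid.\<close>
  obtain k where "t = 2 * k + 1" using \<open>odd t\<close> by (rule oddE)
  with \<open>t \<ge> 7\<close> obtain m where t: "t = 2 * m + 3" and m: "2 \<le> m"
    by (intro that[of "k - 1"]) auto
  have "0 < t" using \<open>t \<ge> 7\<close> by simp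
  let ?La = "\<lambda>n. La n (crown_carrier t) (crown_le t)"
  from eventually_crown[OF \<open>0 < \<epsilon>\<close> m]
  show "eventually (\<lambda>n. dist (real (?La n) / real (n choose (n div 2))) 1 < \<epsilon>) sequentially"
  proof eventually_elim
    case (elim n)
    obtain F where F: "F \<subseteq> Pow {1..n}" "P_free F (crown_carrier t) (crown_le t)" "card F = ?La n"
      using La_crown_bounds(2)[OF \<open>0 < t\<close>, of n] by (elim exE conjE)
    have C: "0 < real (n choose (n div 2))" by simp
    \<comment> \<open>A largest crown-free family cannot reach \<open>1 + \<epsilon>\<close> times
      the middle layer.\<close>
    have "\<not> (1 + \<epsilon>) * (n choose (n div 2)) \<le> card F"
      using elim[rule_format, OF F(1)] F(2) unfolding P_free_def t by (rule contrapos_nn[rotated])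
    then have "real (?La n) < (1 + \<epsilon>) * (n choose (n div 2))" using F(3) by simp
    moreover have "real (n choose (n div 2)) \<le> real (?La n)"
      using La_crown_bounds(1)[OF \<open>0 < t\<close>] by simp
    ultimately have "real (?La n) / real (n choose (n div 2)) < 1 + \<epsilon>" "1 \<le> real (?La n) / real (n choose (n div 2))"
      using C by (simp_all only: pos_divide_less_eq pos_le_divide_eq mult_1)
    then show ?case by (simp add: dist_real_def)
  qed
qed

end
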